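(* Let $\phi\in\Theta$ be such that the Markov chain with transition matrix $P_\phi$ is irreducible (and aperiodic, as all chains considered) and satisfies the drift condition: there exist $\mathcal V:\mathcal X\to[1,\infty)$, $\varepsilon\in(0,1)$, $b\ge 0$ and a finite set $C\subset\mathcal X$ with $$\sum_{y\in\mathcal X}P_\phi(x,y)\mathcal V(y)\le \varepsilon \mathcal V(x)+b\,\mathbb I_C(x)\quad\text{for each }x\in\mathcal X .$$ Suppose that the cost function satisfies $|g(x)|\le \mathcal V(x)$ for each $x\in\mathcal X$. Then for any $\theta\in\Theta$ such that $$D_{\theta,\phi}:=\|(P_\theta-P_\phi)Z_\phi\|_{\mathcal V}<1,$$ the difference of the long-run average costs of the policies $\pi_\phi$ and $\pi_\theta$ is bounded by $$\eta_\theta-\eta_\phi\le N_1(\theta,\phi)+N_2(\theta,\phi),$$ where $N_1(\theta,\phi)$ and $N_2(\theta,\phi)$ are finite and equal to $$N_1(\theta,\phi):=d_\phi^T\left(g-\eta_\phi e+P_\theta h_\phi-h_\phi\right),\qquad N_2(\theta,\phi):=\frac{D_{\theta,\phi}^2}{1-D_{\theta,\phi}}\,\|g-\eta_\phi e\|_{\infty,\mathcal V}\,(d_\phi^T\mathcal V).$$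
   Context: Setting: a Markov decision process with countable state space $\mathcal X$, finite action space $\mathcal A$, one-step cost function $g:\mathcal X\to\mathbb R$, and transition probabilities $P(y|x,a)$ such that $\{y: P(y|x,a)>0\}$ is finite for each $(x,a)$. $\Theta\subset\mathbb R^m$ is open; each $\theta\in\Theta$ determines a randomized stationary Markovian policy $\pi_\theta(a|x)$, with transition matrix $P_\theta(x,y)=\sum_{a\in\mathcal A}\pi_\theta(a|x)P(y|x,a)$. It is assumed that for every $\theta\in\Theta$ the chain with transition matrix $P_\theta$ is irreducible and aperiodic. Norms: for a vector $\nu$ on $\mathcal X$, $\|\nu\|_{\infty,\mathcal V}=\sup_{x}|\nu(x)|/\mathcal V(x)$; for a matrix $M$ on $\mathcal X\times\mathcal X$, $\|M\|_{\mathcal V}=\sup_x\frac1{\mathcal V(x)}\sum_y|M(x,y)|\mathcal V(y)$. $e$ is the all-ones vector; for a distribution $d$ and a function $f$, $d^Tf=\sum_x d(x)f(x)$. $\mathbb I_C$ is the indicator function of $C$. Under the drift condition, $P_\phi$ has a unique stationary distribution $d_\phi$, and $d_\phi^T\mathcal V<\infty$. Let $\Pi_\phi$ be the matrix with every row equal to $d_\phi^T$. The fundamental matrix is $Z_\phi=\sum_{k\ge0}(P_\phi-\Pi_\phi)^k$ (convergent in $\|\cdot\|_{\mathcal V}$, with $\|Z_\phi\|_{\mathcal V}<\infty$). The long-run average cost is $\eta_\theta=d_\theta^Tg$, where $d_\theta$ is the stationary distribution of $P_\theta$ (it exists and is unique when $D_{\theta,\phi}<1$). $h_\phi=Z_\phi(g-\eta_\phi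 e)$ is the fundamental solution of the Poisson equation $g-\eta_\phi e+P_\phi h-h=0$, i.e. the solution with $d_\phi^Th_\phi=0$. *)

theory Defs
  imports "HOL-Probability.Probability"
begin

text \<open>
  Vectors and matrices indexed by the state space are plain functions. Products are infinite sums,
  which take the value 0 where they diverge; convergence is therefore always claimed separately
  wherever finiteness is part of a result.
\<close>

definition mat_vec :: "('x \<Rightarrow> 'x \<Rightarrow> real) \<Rightarrow> ('x \<Rightarrow> real) \<Rightarrow> 'x \<Rightarrow> real" where
  "mat_vec M f x = (\<Sum>\<^sub>\<infinity>y. M x y * f y)"

definition mat_mult :: "('x \<Rightarrow> 'x \<Rightarrow> real) \<Rightarrow> ('x \<Rightarrow> 'x \<Rightarrow> real) \<Rightarrow> 'x \<Rightarrow> 'x \<Rightarrow> real" where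
  "mat_mult M N x y = (\<Sum>\<^sub>\<infinity>z. M x z * N z y)"

definition mat_diff :: "('x \<Rightarrow> 'x \<Rightarrow> real) \<Rightarrow> ('x \<Rightarrow> 'x \<Rightarrow> real) \<Rightarrow> 'x \<Rightarrow> 'x \<Rightarrow> real" where
  "mat_diff M N x y = M x y - N x y"

primrec mat_pow :: "('x \<Rightarrow> 'x \<Rightarrow> real) \<Rightarrow> nat \<Rightarrow> 'x \<Rightarrow> 'x \<Rightarrow> real" where
  "mat_pow M 0 = (\<lambda>x y. if x = y then 1 else 0)"
| "mat_pow M (Suc n) = mat_mult M (mat_pow M n)"

text \<open>Both weighted norms are extended-valued, so that an infinite supremum or an infinite row sum
  is never mistaken for a finite one.\<close>

definition vec_norm :: "('x \<Rightarrow> real) \<Rightarrow> ('x \<Rightarrow> real) \<Rightarrow> ennreal" where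
  "vec_norm V f = (SUP x. ennreal (\<bar>f x\<bar> / V x))"

definition mat_norm :: "('x \<Rightarrow> real) \<Rightarrow> ('x \<Rightarrow> 'x \<Rightarrow> real) \<Rightarrow> ennreal" where
  "mat_norm V M = (SUP x. ennreal (1 / V x) * (\<Sum>\<^sub>\<infinity>y. ennreal (\<bar>M x y\<bar> * V y)))"

definition policy_matrix ::
    "('x \<Rightarrow> 'a::finite \<Rightarrow> 'x pmf) \<Rightarrow> ('x \<Rightarrow> 'a pmf) \<Rightarrow> 'x \<Rightarrow> 'x \<Rightarrow> real" where
  "policy_matrix P \<pi> x y = (\<Sum>a\<in>UNIV. pmf (\<pi> x) a * pmf (P x a) y)"

definition irreducible_chain :: "('x \<Rightarrow> 'x \<Rightarrow> real) \<Rightarrow> bool" where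
  "irreducible_chain M \<longleftrightarrow> (\<forall>x y. \<exists>n. mat_pow M n x y > 0)"

definition aperiodic_chain :: "('x \<Rightarrow> 'x \<Rightarrow> real) \<Rightarrow> bool" where
  "aperiodic_chain M \<longleftrightarrow> (\<forall>x. Gcd {n. n > 0 \<and> mat_pow M n x x > 0} = 1)"

definition drift_condition ::
    "('x \<Rightarrow> 'x \<Rightarrow> real) \<Rightarrow> ('x \<Rightarrow> real) \<Rightarrow> real \<Rightarrow> real \<Rightarrow> 'x set \<Rightarrow> bool" where
  "drift_condition M V \<epsilon> b C \<longleftrightarrow>
     (\<forall>x. V x \<ge> 1) \<and> 0 < \<epsilon> \<and> \<epsilon> < 1 \<and> b \<ge> 0 \<and> finite C \<and>
     (\<forall>x. mat_vec M V x \<le> \<epsilon> * V x + b * indicat_real C x)"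

definition stationary_for :: "('x \<Rightarrow> 'x \<Rightarrow> real) \<Rightarrow> 'x pmf \<Rightarrow> bool" where
  "stationary_for M d \<longleftrightarrow> (\<forall>y. (\<Sum>\<^sub>\<infinity>x. pmf d x * M x y) = pmf d y)"

definition stat_dist :: "('x \<Rightarrow> 'x \<Rightarrow> real) \<Rightarrow> 'x pmf" where
  "stat_dist M = (THE d. stationary_for M d)"

definition dist_sum :: "'x pmf \<Rightarrow> ('x \<Rightarrow> real) \<Rightarrow> real" where
  "dist_sum d f = (\<Sum>\<^sub>\<infinity>x. pmf d x * f x)"

definition dist_summable :: "'x pmf \<Rightarrow> ('x \<Rightarrow> real) \<Rightarrow> bool" where
  "dist_summable d f \<longleftrightarrow> (\<lambda>x. pmf d x * f x) summable_on UNIV"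

definition avg_cost :: "('x \<Rightarrow> 'x \<Rightarrow> real) \<Rightarrow> ('x \<Rightarrow> real) \<Rightarrow> real" where
  "avg_cost M g = dist_sum (stat_dist M) g"

definition stat_matrix :: "('x \<Rightarrow> 'x \<Rightarrow> real) \<Rightarrow> 'x \<Rightarrow> 'x \<Rightarrow> real" where
  "stat_matrix M x y = pmf (stat_dist M) y"

text \<open>The series is summed entrywise; a limit in \<open>mat_norm V\<close> has the same entries.\<close>

definition fund_matrix :: "('x \<Rightarrow> 'x \<Rightarrow> real) \<Rightarrow> 'x \<Rightarrow> 'x \<Rightarrow> real" where
  "fund_matrix M x y = (\<Sum>k. mat_pow (mat_diff M (stat_matrix M)) k x y)"

definition centred_cost :: "('x \<Rightarrow> 'x \<Rightarrow> real) \<Rightarrow> ('x \<Rightarrow> real) \<Rightarrow> 'x \<Rightarrow> real" where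
  "centred_cost M g x = g x - avg_cost M g"

definition poisson_sol :: "('x \<Rightarrow> 'x \<Rightarrow> real) \<Rightarrow> ('x \<Rightarrow> real) \<Rightarrow> 'x \<Rightarrow> real" where
  "poisson_sol M g = mat_vec (fund_matrix M) (centred_cost M g)"

text \<open>Below, \<open>M'\<close> is the matrix of the new policy and \<open>M\<close> that of the reference policy.\<close>

definition policy_deviation ::
    "('x \<Rightarrow> real) \<Rightarrow> ('x \<Rightarrow> 'x \<Rightarrow> real) \<Rightarrow> ('x \<Rightarrow> 'x \<Rightarrow> real) \<Rightarrow> ennreal" where
  "policy_deviation V M' M = mat_norm V (mat_mult (mat_diff M' M) (fund_matrix M))"

definition poisson_residual ::
    "('x \<Rightarrow> 'x \<Rightarrow> real) \<Rightarrow> ('x \<Rightarrow> 'x \<Rightarrow> real) \<Rightarrow> ('x \<Rightarrow> real) \<Rightarrow> 'x \<Rightarrow> real" where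
  "poisson_residual M' M g x =
     g x - avg_cost M g + mat_vec M' (poisson_sol M g) x - poisson_sol M g x"

definition N1 ::
    "('x \<Rightarrow> 'x \<Rightarrow> real) \<Rightarrow> ('x \<Rightarrow> 'x \<Rightarrow> real) \<Rightarrow> ('x \<Rightarrow> real) \<Rightarrow> real" where
  "N1 M' M g = dist_sum (stat_dist M) (poisson_residual M' M g)"

definition N2 ::
    "('x \<Rightarrow> real) \<Rightarrow> ('x \<Rightarrow> 'x \<Rightarrow> real) \<Rightarrow> ('x \<Rightarrow> 'x \<Rightarrow> real) \<Rightarrow> ('x \<Rightarrow> real) \<Rightarrow> ennreal" where
  "N2 V M' M g =
     (policy_deviation V M' M)\<^sup>2 / (1 - policy_deviation V M' M) * vec_norm V (centred_cost M g)
       * (\<Sum>\<^sub>\<infinity>x. ennreal (pmf (stat_dist M) x * V x))"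

end

theory Submission
  imports Defs
begin

text \<open>Matrices with finite \<open>V\<close>-norm form a Banach algebra. In it, write \<open>p\<close> for \<open>P\<^sub>\<phi>\<close>, \<open>e\<close> for the
  matrix whose \<open>z\<close>-column is \<open>1\<close> and which vanishes elsewhere, and \<open>\<pi>\<close> for \<open>\<Pi>\<^sub>\<phi>\<close>. Drift and
  aperiodicity give \<open>p\<^sup>N = q + \<delta> e\<close> where the powers of \<open>q\<close> are summable in norm. Since \<open>p e = e\<close>, the
  matrix \<open>\<pi> = \<delta> e (1 - q)\<^sup>-\<^sup>1\<close> is the stationary projection, \<open>(p - \<pi>)\<^sup>N\<^sup>n = (1 - \<pi>) q\<^sup>n\<close> for \<open>n \<ge> 1\<close>, and the fundamental
  matrix \<open>Z = (1 - p + \<pi>)\<^sup>-\<^sup>1\<close> exists.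

  For \<open>m = (P\<^sub>\<theta> - P\<^sub>\<phi>) Z\<close> of norm less than \<open>1\<close>, the matrix \<open>\<nu> = \<pi> (1 - m)\<^sup>-\<^sup>1\<close> satisfies \<open>\<nu> P\<^sub>\<theta> = \<nu>\<close>;
  by irreducibility an invariant signed measure has constant sign, so the rows of \<open>\<nu>\<close> are \<open>d\<^sub>\<theta>\<close>. In the
  expansion of \<open>\<nu> (g - \<eta>\<^sub>\<phi>)\<close> in powers of \<open>m\<close>, the term of order \<open>0\<close> vanishes, the term of order \<open>1\<close> is \<open>N\<^sub>1\<close>, and the tail of the geometric series is at most \<open>N\<^sub>2\<close>.\<close>

section \<open>The Banach algebra of row-bounded matrices\<close>

lemma has_sum_finite_sum:
  fixes f :: "'i \<Rightarrow> 'x \<Rightarrow> real"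
  assumes "\<And>i. i \<in> I \<Longrightarrow> (f i has_sum s i) A"
  shows "((\<lambda>x. \<Sum>i\<in>I. f i x) has_sum (\<Sum>i\<in>I. s i)) A"
  using assms by (induction I rule: infinite_finite_induct) (auto intro: has_sum_add)

text \<open>Bounding all finite partial sums yields absolute summability of every row together with
  a uniform bound on its sum, with no separate convergence condition.\<close>

definition row_bounded :: "real \<Rightarrow> ('x \<Rightarrow> 'x \<Rightarrow> real) \<Rightarrow> bool" where
  "row_bounded c K \<longleftrightarrow> (\<forall>x F. finite F \<longrightarrow> (\<Sum>y\<in>F. \<bar>K x y\<bar>) \<le> c)"

lemma row_boundedD: "row_bounded c K \<Longrightarrow> finite F \<Longrightarrow> (\<Sum>y\<in>F. \<bar>K x y\<bar>) \<le> c"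
  by (auto simp: row_bounded_def)

lemma row_bounded_nonneg: "row_bounded c K \<Longrightarrow> 0 \<le> c"
  using row_boundedD[of c K "{}"] by simp

lemma row_bounded_add:
  assumes "row_bounded c K" "row_bounded d L"
  shows "row_bounded (c + d) (\<lambda>x y. K x y + L x y)"
  unfolding row_bounded_def
proof (intro allI impI)
  fix x and F :: "'a set" assume F: "finite F"
  have "(\<Sum>y\<in>F. \<bar>K x y + L x y\<bar>) \<le> (\<Sum>y\<in>F. \<bar>K x y\<bar>) + (\<Sum>y\<in>F. \<bar>L x y\<bar>)"
    unfolding sum.distrib[symmetric] by (intro sum_mono) simp
  with row_boundedD[OF assms(1) F] row_boundedD[OF assms(2) F]
  show "(\<Sum>y\<in>F. \<bar>K x y + L x y\<bar>) \<le> c + d" by (meson add_mono order_trans)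
qed

lemma row_bounded_scale:
  assumes "row_bounded c K"
  shows "row_bounded (\<bar>a\<bar> * c) (\<lambda>x y. a * K x y)"
  using assms unfolding row_bounded_def
  by (auto simp: abs_mult sum_distrib_left[symmetric] intro!: mult_left_mono)

lemma abs_le_row_bound:
  assumes "row_bounded c K"
  shows "\<bar>K x y\<bar> \<le> c"
  using row_boundedD[OF assms, of "{y}"] by simp

lemma row_summable:
  assumes "row_bounded c K"
  shows "(\<lambda>y. \<bar>K x y\<bar>) summable_on UNIV" and "(\<Sum>\<^sub>\<infinity>y. \<bar>K x y\<bar>) \<le> c"
proof -
  show *: "(\<lambda>y. \<bar>K x y\<bar>) summable_on UNIV"
    by (rule nonneg_bdd_above_summable_on) (use assms in \<open>auto simp: row_bounded_def bdd_above_def\<close>)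
  show "(\<Sum>\<^sub>\<infinity>y. \<bar>K x y\<bar>) \<le> c"
    by (rule infsum_le_finite_sums[OF *]) (use assms in \<open>auto simp: row_bounded_def\<close>)
qed

lemma mult_row_summable:
  assumes "row_bounded c K" "\<And>z. \<bar>f z\<bar> \<le> d"
  shows "(\<lambda>z. \<bar>K x z * f z\<bar>) summable_on UNIV" and "(\<lambda>z. K x z * f z) summable_on UNIV"
proof -
  show *: "(\<lambda>z. \<bar>K x z * f z\<bar>) summable_on UNIV"
  proof (rule summable_on_comparison_test)
    show "(\<lambda>z. \<bar>K x z\<bar> * d) summable_on UNIV"
      by (intro summable_on_cmult_left row_summable(1)[OF assms(1)])
  qed (auto simp: abs_mult assms(2) mult_left_mono)
  then show "(\<lambda>z. K x z * f z) summable_on UNIV"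
    using summable_on_iff_abs_summable_on_real by force
qed

lemma mult_rows_summable:
  assumes "row_bounded c K" "row_bounded d L"
  shows "(\<lambda>z. \<bar>K x z * L z y\<bar>) summable_on UNIV" and "(\<lambda>z. K x z * L z y) summable_on UNIV"
  using mult_row_summable[OF assms(1), of "\<lambda>z. L z y" d x] abs_le_row_bound[OF assms(2)] by auto

text \<open>Only finite sets \<open>F\<close> of columns have to be controlled, so a finite sum is
  exchanged with one infinite sum; \<open>d\<close> then bounds each row of
  \<open>L\<close>.\<close>

lemma row_bounded_mat_mult:
  assumes K: "row_bounded c K" and L: "row_bounded d L"
  shows "row_bounded (c * d) (mat_mult K L)"
  unfolding row_bounded_def
proof (intro allI impI)
  fix x and F :: "'a set" assume F: "finite F"
  note s = mult_rows_summable[OF K L]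
  have "(\<Sum>y\<in>F. \<bar>mat_mult K L x y\<bar>) \<le> (\<Sum>y\<in>F. \<Sum>\<^sub>\<infinity>z. \<bar>K x z * L z y\<bar>)"
    unfolding mat_mult_def using norm_infsum_bound[of "\<lambda>z. K x z * L z _"] s(1)
    by (intro sum_mono) auto
  also have "\<dots> = (\<Sum>\<^sub>\<infinity>z. \<Sum>y\<in>F. \<bar>K x z * L z y\<bar>)"
    by (intro infsumI[symmetric] has_sum_finite_sum has_sum_infsum s(1))
  also have "\<dots> \<le> (\<Sum>\<^sub>\<infinity>z. \<bar>K x z\<bar> * d)"
  proof (rule infsum_mono)
    show "(\<lambda>z. \<Sum>y\<in>F. \<bar>K x z * L z y\<bar>) summable_on UNIV"
      by (rule has_sum_imp_summable, rule has_sum_finite_sum, rule has_sum_infsum, rule s(1))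
    show "(\<lambda>z. \<bar>K x z\<bar> * d) summable_on UNIV"
      by (intro summable_on_cmult_left row_summable(1)[OF K])
    show "(\<Sum>y\<in>F. \<bar>K x z * L z y\<bar>) \<le> \<bar>K x z\<bar> * d" for z
      unfolding abs_mult sum_distrib_left[symmetric]
      by (intro mult_left_mono row_boundedD[OF L F]) auto
  qed
  also have "\<dots> = (\<Sum>\<^sub>\<infinity>z. \<bar>K x z\<bar>) * d"
    by (rule infsum_cmult_left')
  also have "\<dots> \<le> c * d"
    by (intro mult_right_mono row_summable(2)[OF K] row_bounded_nonneg[OF L])
  finally show "(\<Sum>y\<in>F. \<bar>mat_mult K L x y\<bar>) \<le> c * d" .
qed

text \<open>Fubini over pairs of intermediate states. The inner absolute sums are at most
  \<open>d * e\<close> uniformly, and a row of \<open>K\<close> is summable against a bounded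
  function.\<close>

lemma mat_mult_assoc_row_bounded:
  assumes K: "row_bounded c K" and L: "row_bounded d L" and N: "row_bounded e N"
  shows "mat_mult (mat_mult K L) N = mat_mult K (mat_mult L N)"
proof (intro ext)
  fix x y
  have "(\<lambda>p. norm (K x (fst p) * L (fst p) (snd p) * N (snd p) y)) summable_on UNIV \<times> UNIV"
  proof (rule iffD2[OF Infinite_Sum.abs_summable_on_Sigma_iff], intro conjI ballI)
    fix z
    have "(\<lambda>w. \<bar>K x z\<bar> * \<bar>L z w * N w y\<bar>) summable_on UNIV"
      by (intro summable_on_cmult_right mult_rows_summable(1)[OF L N])
    then show "(\<lambda>w. norm (K x (fst (z, w)) * L (fst (z, w)) (snd (z, w)) * N (snd (z, w)) y)) summable_on UNIV"
      by (simp add: abs_mult mult.assoc)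
  next
    have eq: "(\<Sum>\<^sub>\<infinity>w. norm (K x (fst (z, w)) * L (fst (z, w)) (snd (z, w)) * N (snd (z, w)) y))
        = \<bar>K x z\<bar> * (\<Sum>\<^sub>\<infinity>w. \<bar>L z w * N w y\<bar>)" for z
      unfolding infsum_cmult_right'[symmetric] by (simp add: abs_mult mult.assoc)
    have b: "\<bar>\<Sum>\<^sub>\<infinity>w. \<bar>L z w * N w y\<bar>\<bar> \<le> d * e" for z
    proof -
      have "(\<Sum>\<^sub>\<infinity>w. \<bar>L z w * N w y\<bar>) \<le> (\<Sum>\<^sub>\<infinity>w. \<bar>L z w\<bar> * e)"
        by (intro infsum_mono mult_rows_summable(1)[OF L N]
            summable_on_cmult_left row_summable(1)[OF L])
           (simp add: abs_mult mult_left_mono abs_le_row_bound[OF N])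
      also have "\<dots> \<le> d * e"
        unfolding infsum_cmult_left'
        by (intro mult_right_mono row_summable(2)[OF L] row_bounded_nonneg[OF N])
      finally show ?thesis by (simp add: infsum_nonneg)
    qed
    show "(\<lambda>z. norm (\<Sum>\<^sub>\<infinity>w. norm (K x (fst (z, w)) * L (fst (z, w)) (snd (z, w)) * N (snd (z, w)) y))) summable_on UNIV"
      unfolding eq using mult_row_summable(1)[OF K b] by (simp add: abs_mult)
  qed
  then have "(\<lambda>(z, w). K x z * L z w * N w y) summable_on UNIV \<times> UNIV"
    unfolding case_prod_unfold by (rule iffD2[OF summable_on_iff_abs_summable_on_real])
  then have "(\<Sum>\<^sub>\<infinity>z. \<Sum>\<^sub>\<infinity>w. K x z * L z w * N w y) = (\<Sum>\<^sub>\<infinity>w. \<Sum>\<^sub>\<infinity>z. K x z * L z w * N w y)"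
    by (rule infsum_swap_banach)
  then show "mat_mult (mat_mult K L) N x y = mat_mult K (mat_mult L N) x y"
    unfolding mat_mult_def infsum_cmult_left'[symmetric] infsum_cmult_right'[symmetric]
    by (simp add: mult.assoc)
qed

text \<open>Bundling the row bound into a type makes associativity and distributivity unconditional,
  so that later arguments become algebra.\<close>

typedef 'x kern = "{K :: 'x \<Rightarrow> 'x \<Rightarrow> real. \<exists>c. row_bounded c K}" morphisms ent Kern
  by (rule exI[of _ "\<lambda>_ _. 0"]) (auto simp: row_bounded_def intro!: exI[of _ 0])

lemma ent_Kern: "row_bounded c K \<Longrightarrow> ent (Kern K) = K"
  by (subst Kern_inverse) auto

lemma kern_eqI: "(\<And>x y. ent K x y = ent L x y) \<Longrightarrow> K = L"
  by (metis ent_inject ext)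

lemma ent_row_bounded_ex: "\<exists>c. row_bounded c (ent K)"
  using ent[of K] by simp

section \<open>Norm, algebra laws and completeness of kernels\<close>

instantiation kern :: (type) real_normed_algebra_1
begin

definition "zero_kern = Kern (\<lambda>_ _. 0)"
definition "one_kern = Kern (\<lambda>x y. if x = y then 1 else 0)"
definition "plus_kern K L = Kern (\<lambda>x y. ent K x y + ent L x y)"
definition "uminus_kern K = Kern (\<lambda>x y. - ent K x y)"
definition "minus_kern K L = Kern (\<lambda>x y. ent K x y - ent L x y)"
definition "times_kern K L = Kern (mat_mult (ent K) (ent L))"
definition "scaleR_kern a K = Kern (\<lambda>x y. a * ent K x y)"
definition "norm_kern K = Inf {c. row_bounded c (ent K)}"
definition "dist_kern (K :: 'a kern) L = norm (K - L)"
definition "sgn_kern (K :: 'a kern) = inverse (norm K) *\<^sub>R K"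
definition "(uniformity :: ('a kern \<times> 'a kern) filter) = (INF e\<in>{0<..}. principal {(x, y). dist x y < e})"
definition "open_kern S = (\<forall>x\<in>S. \<forall>\<^sub>F (x', y) in uniformity. x' = x \<longrightarrow> (y :: 'a kern) \<in> S)"

text \<open>The infimum defining the norm is attained: each finite partial sum is a lower bound for
  the set of admissible constants.\<close>

lemma row_bounded_ent_norm: "row_bounded (norm K) (ent K)"
  unfolding row_bounded_def
proof (intro allI impI)
  fix x and F :: "'a set" assume F: "finite F"
  show "(\<Sum>y\<in>F. \<bar>ent K x y\<bar>) \<le> norm K"
    unfolding norm_kern_def using ent_row_bounded_ex[of K] F
    by (intro cInf_greatest) (auto simp: row_bounded_def)
qed

lemma norm_kern_le: "row_bounded c (ent K) \<Longrightarrow> norm K \<le> c"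
  unfolding norm_kern_def
  by (rule cInf_lower) (auto simp: bdd_below_def intro: row_bounded_nonneg)

lemma row_bounded_one: "row_bounded 1 (\<lambda>x y. if x = y then 1 else 0)"
  unfolding row_bounded_def by (auto simp: if_distrib[of abs] sum.delta' cong: if_cong)

lemma ent_zero [simp]: "ent 0 = (\<lambda>x y. 0)"
  unfolding zero_kern_def by (rule ent_Kern[of 0]) (auto simp: row_bounded_def)

lemma ent_one: "ent 1 = (\<lambda>x y. if x = y then 1 else 0)"
  unfolding one_kern_def by (rule ent_Kern[OF row_bounded_one])

lemma ent_plus [simp]: "ent (K + L) x y = ent K x y + ent L x y"
  unfolding plus_kern_def
  by (simp add: ent_Kern[OF row_bounded_add[OF row_bounded_ent_norm row_bounded_ent_norm]])

lemma ent_scaleR [simp]: "ent (a *\<^sub>R K) x y = a * ent K x y"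
  unfolding scaleR_kern_def by (simp add: ent_Kern[OF row_bounded_scale[OF row_bounded_ent_norm]])

lemma ent_uminus [simp]: "ent (- K) x y = - ent K x y"
  unfolding uminus_kern_def
  using ent_Kern[OF row_bounded_scale[OF row_bounded_ent_norm], of "-1" K] by simp

lemma ent_minus [simp]: "ent (K - L) x y = ent K x y - ent L x y"
  unfolding minus_kern_def
  using ent_Kern[OF row_bounded_add[OF row_bounded_ent_norm row_bounded_ent_norm], of K "- L"] by simp

lemma ent_times: "ent (K * L) = mat_mult (ent K) (ent L)"
  unfolding times_kern_def
  by (rule ent_Kern[OF row_bounded_mat_mult[OF row_bounded_ent_norm row_bounded_ent_norm]])

lemma summable_ent_times:
  fixes K L :: "'a kern"
  shows "(\<lambda>z. ent K x z * ent L z y) summable_on UNIV"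
  using mult_rows_summable(2)[OF row_bounded_ent_norm[of K] row_bounded_ent_norm[of L]] by simp

instance
proof
  fix K L N :: "'a kern" and a b :: real
  show "K * L * N = K * (L * N)"
    by (rule kern_eqI)
       (simp add: ent_times mat_mult_assoc_row_bounded[OF row_bounded_ent_norm row_bounded_ent_norm row_bounded_ent_norm])
  show "(K + L) * N = K * N + L * N"
    by (rule kern_eqI) (simp add: ent_times mat_mult_def distrib_right infsum_add summable_ent_times)
  show "K * (L + N) = K * L + K * N"
    by (rule kern_eqI) (simp add: ent_times mat_mult_def distrib_left infsum_add summable_ent_times)
  show "(a *\<^sub>R K) * L = a *\<^sub>R (K * L)"
    by (rule kern_eqI) (simp add: ent_times mat_mult_def infsum_cmult_right' mult.assoc)
  show "K * (a *\<^sub>R L) = a *\<^sub>R (K * L)"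
    by (rule kern_eqI) (simp add: ent_times mat_mult_def infsum_cmult_right'[symmetric] mult.left_commute)
  have eq: "(\<Sum>\<^sub>\<infinity>z. f z * (if z = y then 1 else 0)) = f y" "(\<Sum>\<^sub>\<infinity>z. (if y = z then 1 else 0) * f z) = f y"
    for y :: 'a and f :: "'a \<Rightarrow> real"
    using infsum_cong_neutral[of "{y}" UNIV f "\<lambda>z. f z * (if z = y then 1 else 0)"]
      infsum_cong_neutral[of "{y}" UNIV f "\<lambda>z. (if y = z then 1 else 0) * f z"] by auto
  show "1 * K = K" "K * 1 = K"
    by (auto intro!: kern_eqI simp: ent_times ent_one mat_mult_def eq)
  show "(0 :: 'a kern) \<noteq> 1"
  proof
    assume "(0 :: 'a kern) = 1"
    from arg_cong[OF this, of "\<lambda>K. ent K undefined undefined"] show False by (simp add: ent_one)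
  qed
  show "norm (a *\<^sub>R K) = \<bar>a\<bar> * norm K"
  proof (cases "a = 0")
    case True
    have "norm (0 :: 'a kern) = 0"
      using norm_kern_le[of 0 "0 :: 'a kern"] row_bounded_nonneg[OF row_bounded_ent_norm[of "0 :: 'a kern"]]
      by (force simp: row_bounded_def)
    moreover have "a *\<^sub>R K = 0" by (rule kern_eqI) (simp add: True)
    ultimately show ?thesis using True by simp
  next
    case False
    \<comment> \<open>Homogeneity needs only this inequality: applied to \<open>inverse a\<close>
      and \<open>a *\<^sub>R K\<close>, it gives the reverse one.\<close>
    have 1: "norm (c *\<^sub>R N) \<le> \<bar>c\<bar> * norm N" for c and N :: "'a kern"
      by (rule norm_kern_le) (use row_bounded_scale[OF row_bounded_ent_norm[of N], of c] in \<open>simp add: row_bounded_def\<close>)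
    have "K = inverse a *\<^sub>R a *\<^sub>R K" by (rule kern_eqI) (simp add: False)
    with 1[of "inverse a" "a *\<^sub>R K"] have "\<bar>a\<bar> * norm K \<le> norm (a *\<^sub>R K)"
      using False by (simp add: field_simps)
    with 1[of a K] show ?thesis by linarith
  qed
  show "norm (K + L) \<le> norm K + norm L"
    by (rule norm_kern_le)
       (use row_bounded_add[OF row_bounded_ent_norm[of K] row_bounded_ent_norm[of L]] in \<open>simp add: row_bounded_def\<close>)
  show "norm (K * L) \<le> norm K * norm L"
    by (rule norm_kern_le) (simp add: ent_times row_bounded_mat_mult row_bounded_ent_norm)
  show "norm K = 0 \<longleftrightarrow> K = 0"
  proof
    assume "norm K = 0"
    then show "K = 0" using abs_le_row_bound[OF row_bounded_ent_norm[of K]] by (intro kern_eqI) simp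
  next
    assume "K = 0"
    then show "norm K = 0"
      using norm_kern_le[of 0 K] row_bounded_nonneg[OF row_bounded_ent_norm[of K]] by (force simp: row_bounded_def)
  qed
  show "norm (1 :: 'a kern) = 1"
  proof (rule antisym)
    show "norm (1 :: 'a kern) \<le> 1" by (rule norm_kern_le) (simp add: ent_one row_bounded_one)
    show "1 \<le> norm (1 :: 'a kern)"
      using abs_le_row_bound[OF row_bounded_ent_norm[of "1 :: 'a kern"], of undefined undefined] by (simp add: ent_one)
  qed
qed (auto intro!: kern_eqI simp: algebra_simps dist_kern_def sgn_kern_def uniformity_kern_def open_kern_def)

end

lemma abs_ent_le_norm: "\<bar>ent K x y\<bar> \<le> norm K"
  by (rule abs_le_row_bound[OF row_bounded_ent_norm])

lemma bounded_linear_ent: "bounded_linear (\<lambda>K. ent K x y)"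
  by (rule bounded_linear_intro[where K = 1]) (auto simp: abs_ent_le_norm)

text \<open>Entries are continuous, so an entrywise limit exists. The Cauchy estimate for finite
  partial sums survives letting \<open>m\<close> tend to infinity and becomes convergence in
  norm.\<close>

instance kern :: (type) banach
proof
  fix X :: "nat \<Rightarrow> 'a kern" assume X: "Cauchy X"
  have "Cauchy (\<lambda>n. ent (X n) x y)" for x y
    by (rule bounded_linear.Cauchy[OF bounded_linear_ent X])
  then have "\<forall>x y. \<exists>l. (\<lambda>n. ent (X n) x y) \<longlonglongrightarrow> l"
    by (simp add: Cauchy_convergent_iff convergent_def)
  then obtain l where l: "\<And>x y. (\<lambda>n. ent (X n) x y) \<longlonglongrightarrow> l x y" by metis
  have close: "\<exists>M. \<forall>n\<ge>M. row_bounded e (\<lambda>x y. ent (X n) x y - l x y)" if "e > 0" for e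
  proof -
    from X that obtain M where M: "\<And>m n. m \<ge> M \<Longrightarrow> n \<ge> M \<Longrightarrow> norm (X m - X n) < e"
      unfolding Cauchy_def dist_norm by blast
    have "(\<Sum>y\<in>F. \<bar>ent (X n) x y - l x y\<bar>) \<le> e" if "n \<ge> M" "finite F" for n x and F :: "'a set"
    proof (rule LIMSEQ_le_const2)
      show "(\<lambda>m. \<Sum>y\<in>F. \<bar>ent (X n) x y - ent (X m) x y\<bar>) \<longlonglongrightarrow> (\<Sum>y\<in>F. \<bar>ent (X n) x y - l x y\<bar>)"
        by (intro tendsto_intros l)
      have "(\<Sum>y\<in>F. \<bar>ent (X n) x y - ent (X m) x y\<bar>) \<le> e" if "m \<ge> M" for m
        using row_boundedD[OF row_bounded_ent_norm[of "X n - X m"] \<open>finite F\<close>, of x] M[OF \<open>n \<ge> M\<close> that] by simp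
      then show "\<exists>N. \<forall>m\<ge>N. (\<Sum>y\<in>F. \<bar>ent (X n) x y - ent (X m) x y\<bar>) \<le> e" by blast
    qed
    then show ?thesis by (auto simp: row_bounded_def)
  qed
  \<comment> \<open>One close approximation already makes \<open>l\<close> row bounded, so
    \<open>Kern l\<close> really has the entries \<open>l\<close>.\<close>
  from close[of 1] obtain M where "row_bounded 1 (\<lambda>x y. ent (X M) x y - l x y)" by auto
  from row_bounded_add[OF row_bounded_ent_norm[of "X M"] row_bounded_scale[OF this, of "-1"]]
  have entL: "ent (Kern l) = l" by (intro ent_Kern) auto
  have "X \<longlonglongrightarrow> Kern l"
  proof (rule LIMSEQ_I)
    fix r :: real assume "0 < r"
    with close[of "r / 2"] obtain M where M: "\<forall>n\<ge>M. row_bounded (r / 2) (\<lambda>x y. ent (X n) x y - l x y)" by auto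
    have "norm (X n - Kern l) \<le> r / 2" if "n \<ge> M" for n
      by (rule norm_kern_le) (use M that in \<open>simp add: entL row_bounded_def\<close>)
    with \<open>0 < r\<close> show "\<exists>N. \<forall>n\<ge>N. norm (X n - Kern l) < r" by (force intro!: exI[of _ M])
  qed
  then show "convergent X" by (auto simp: convergent_def)
qed

section \<open>Weighted norms\<close>

text \<open>A matrix of finite \<open>V\<close>-norm is encoded by its conjugate \<open>K x y * V y / V x\<close>, which turns the
  weighted norm into the unweighted one; \<open>entry\<close> undoes the conjugation. Vectors become matrices:
  a distribution is a matrix with constant rows, a function is a single nonzero column.\<close>

locale weight =
  fixes V :: "'x \<Rightarrow> real"
  assumes pos: "0 < V x"
begin

definition entry :: "'x kern \<Rightarrow> 'x \<Rightarrow> 'x \<Rightarrow> real" where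
  "entry A x y = ent A x y * V x / V y"

lemma nonzero: "V x \<noteq> 0"
  using pos[of x] by simp

lemma entry_eqI: "entry A = entry B \<Longrightarrow> A = B"
  by (rule kern_eqI) (metis entry_def divide_cancel_right mult_cancel_right nonzero)

lemma abs_entry: "\<bar>entry A x y\<bar> * V y = \<bar>ent A x y\<bar> * V x"
  using pos[of x] pos[of y] by (simp add: entry_def abs_mult)

lemma entry_row_bound: "finite F \<Longrightarrow> (\<Sum>y\<in>F. \<bar>entry A x y\<bar> * V y) \<le> norm A * V x"
  unfolding abs_entry sum_distrib_right[symmetric]
  by (intro mult_right_mono row_boundedD[OF row_bounded_ent_norm] less_imp_le[OF pos])

lemma norm_entry_le:
  assumes "\<And>x F. finite F \<Longrightarrow> (\<Sum>y\<in>F. \<bar>entry A x y\<bar> * V y) \<le> c * V x"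
  shows "norm A \<le> c"
  by (rule norm_kern_le)
     (use assms in \<open>simp add: row_bounded_def abs_entry sum_distrib_right[symmetric] pos\<close>)

text \<open>Concrete matrices enter the algebra through this rule: a uniform weighted row bound is
  exactly row boundedness of the conjugated matrix.\<close>

lemma entry_cases:
  assumes "\<And>x F. finite F \<Longrightarrow> (\<Sum>y\<in>F. \<bar>K x y\<bar> * V y) \<le> c * V x"
  obtains A where "entry A = K" "norm A \<le> c"
proof -
  let ?L = "\<lambda>x y. K x y * V y / V x"
  have abs: "\<bar>?L x y\<bar> = \<bar>K x y\<bar> * V y / V x" for x y
    using pos[of x] pos[of y] by (simp add: abs_mult)
  have "row_bounded c ?L"
    unfolding row_bounded_def abs sum_divide_distrib[symmetric]
    using assms pos by (simp add: divide_le_eq)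
  note L = ent_Kern[OF this]
  have "entry (Kern ?L) = K"
    by (intro ext) (simp add: entry_def L nonzero)
  moreover from this have "norm (Kern ?L) \<le> c"
    using assms by (intro norm_entry_le) simp
  ultimately show ?thesis by (rule that)
qed

lemma entry_zero [simp]: "entry 0 x y = 0"
  by (simp add: entry_def)

lemma entry_one: "entry 1 = (\<lambda>x y. if x = y then 1 else 0)"
  by (intro ext) (simp add: entry_def ent_one nonzero)

lemma entry_add [simp]: "entry (A + B) x y = entry A x y + entry B x y"
  by (simp add: entry_def algebra_simps add_divide_distrib)

lemma entry_diff [simp]: "entry (A - B) x y = entry A x y - entry B x y"
  by (simp add: entry_def algebra_simps diff_divide_distrib)

lemma entry_scaleR [simp]: "entry (a *\<^sub>R A) x y = a * entry A x y"
  by (simp add: entry_def)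

lemma entry_mult_summand:
  "entry A x z * entry B z y = ent A x z * ent B z y * (V x / V y)"
  using nonzero[of z] by (simp add: entry_def)

lemma summable_entry_mult: "(\<lambda>z. entry A x z * entry B z y) summable_on UNIV"
  unfolding entry_mult_summand by (intro summable_on_cmult_left summable_ent_times)

text \<open>Conjugation by a diagonal matrix respects products, since the weight of the intermediate
  state cancels.\<close>

lemma entry_mult: "entry (A * B) = mat_mult (entry A) (entry B)"
  by (intro ext)
     (simp only: mat_mult_def entry_mult_summand infsum_cmult_left', simp add: entry_def ent_times mat_mult_def)

lemma entry_mult_has_sum: "((\<lambda>z. entry A x z * entry B z y) has_sum entry (A * B) x y) UNIV"
  unfolding entry_mult mat_mult_def by (rule has_sum_infsum[OF summable_entry_mult])

lemma entry_power: "entry (A ^ n) = mat_pow (entry A) n"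
  by (induction n) (simp_all add: entry_one entry_mult)

lemma bounded_linear_entry: "bounded_linear (\<lambda>A. entry A x y)"
  unfolding entry_def
  using bounded_linear_const_mult[OF bounded_linear_ent, of "V x / V y" x y] by (simp add: mult.commute)

lemma entry_weight_summable:
  shows "(\<lambda>y. \<bar>entry A x y\<bar> * V y) summable_on UNIV"
    and "(\<Sum>\<^sub>\<infinity>y. \<bar>entry A x y\<bar> * V y) \<le> norm A * V x"
proof -
  show *: "(\<lambda>y. \<bar>entry A x y\<bar> * V y) summable_on UNIV"
    unfolding abs_entry by (intro summable_on_cmult_left row_summable(1)[OF row_bounded_ent_norm])
  show "(\<Sum>\<^sub>\<infinity>y. \<bar>entry A x y\<bar> * V y) \<le> norm A * V x"
    by (rule infsum_le_finite_sums[OF *]) (rule entry_row_bound)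
qed

lemma abs_entry_le: "\<bar>entry A x y\<bar> * V y \<le> norm A * V x"
  using entry_row_bound[of "{y}" A x] by simp

end

section \<open>Stationary projections in Banach algebras\<close>

text \<open>Writing exponents as \<open>j * m + i\<close> with \<open>i < m\<close> bounds the
  partial sums by a geometric series in \<open>norm (x ^ m)\<close> times the finite sum
  \<open>S\<close>.\<close>

lemma summable_norm_power:
  fixes x :: "'a::real_normed_algebra_1"
  assumes "norm (x ^ m) < 1"
  shows "summable (\<lambda>k. norm (x ^ k))"
proof (rule summableI_nonneg_bounded)
  have m: "m > 0" using assms by (cases m) auto
  define r where "r = norm (x ^ m)"
  define S where "S = (\<Sum>i<m. norm (x ^ i))"
  fix n
  have "{..<n} \<subseteq> {..<n * m}" using m by (cases m) auto
  then have "(\<Sum>k<n. norm (x ^ k)) \<le> (\<Sum>k<n * m. norm (x ^ k))"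
    by (intro sum_mono2) auto
  also have "\<dots> = (\<Sum>j<n. \<Sum>k = j * m..<j * m + m. norm (x ^ k))"
    by (rule sum.nat_group[symmetric])
  also have "\<dots> \<le> (\<Sum>j<n. r ^ j * S)"
  proof (rule sum_mono)
    fix j
    have "(\<Sum>k = j * m..<j * m + m. norm (x ^ k)) = (\<Sum>i<m. norm (x ^ (j * m + i)))"
      using sum.shift_bounds_nat_ivl[of "\<lambda>k. norm (x ^ k)" 0 "j * m" m]
      by (simp only: add.commute[of _ "j * m"] add_0_right lessThan_atLeast0)
    also have "\<dots> \<le> (\<Sum>i<m. r ^ j * norm (x ^ i))"
    proof (rule sum_mono)
      fix i
      have "x ^ (j * m + i) = (x ^ m) ^ j * x ^ i"
        by (simp only: power_add power_mult mult.commute[of j m])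
      then show "norm (x ^ (j * m + i)) \<le> r ^ j * norm (x ^ i)"
        unfolding r_def
        by (simp only:) (rule order_trans[OF norm_mult_ineq mult_right_mono[OF norm_power_ineq norm_ge_zero]])
    qed
    finally show "(\<Sum>k = j * m..<j * m + m. norm (x ^ k)) \<le> r ^ j * S"
      by (simp add: S_def sum_distrib_left)
  qed
  also have "\<dots> = (\<Sum>j<n. r ^ j) * S" by (simp add: sum_distrib_right)
  also have "\<dots> \<le> (1 / (1 - r)) * S"
  proof (rule mult_right_mono)
    have "(\<Sum>j<n. r ^ j) \<le> (\<Sum>j. r ^ j)"
      using assms by (intro sum_le_suminf) (auto simp: r_def summable_geometric)
    then show "(\<Sum>j<n. r ^ j) \<le> 1 / (1 - r)"
      using assms by (simp add: r_def suminf_geometric)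
  qed (simp add: S_def sum_nonneg)
  finally show "(\<Sum>k<n. norm (x ^ k)) \<le> (1 / (1 - r)) * S" .
qed simp

lemma geometric_resolvent:
  fixes x :: "'a::{real_normed_algebra_1,banach}"
  assumes "summable (\<lambda>k. norm (x ^ k))"
  shows "(1 - x) * (\<Sum>k. x ^ k) = 1" and "(\<Sum>k. x ^ k) * (1 - x) = 1"
proof -
  note s = summable_norm_cancel[OF assms]
  have "(\<Sum>k. x ^ Suc k) = (\<Sum>k. x ^ k) - 1"
    using suminf_split_head[OF s] by simp
  then have "x * (\<Sum>k. x ^ k) = (\<Sum>k. x ^ k) - 1" "(\<Sum>k. x ^ k) * x = (\<Sum>k. x ^ k) - 1"
    using suminf_mult[OF s, of x] suminf_mult2[OF s, of x] by (simp_all add: power_commutes)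
  then show "(1 - x) * (\<Sum>k. x ^ k) = 1" "(\<Sum>k. x ^ k) * (1 - x) = 1"
    by (simp_all add: algebra_simps)
qed

lemma norm_geometric_le:
  fixes x :: "'a::{real_normed_algebra_1,banach}"
  assumes "norm x < 1"
  shows "norm (\<Sum>k. x ^ k) \<le> 1 / (1 - norm x)"
proof -
  have s: "summable (\<lambda>k. norm x ^ k)" using assms by simp
  have "norm (\<Sum>k. x ^ k) \<le> (\<Sum>k. norm x ^ k)"
    by (rule norm_suminf_le[OF norm_power_ineq s])
  then show ?thesis using assms by (simp add: suminf_geometric)
qed

text \<open>From \<open>p * e = e\<close> follows \<open>(1 - q) * e = \<delta> *\<^sub>R e\<close>,
  which fixes the normalization of the projection \<open>\<delta> *\<^sub>R (e * G)\<close>.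
  Summability then needs only one power of \<open>p - \<pi>\<close> of norm below
  \<open>1\<close>.\<close>

lemma minorized_power_projection:
  fixes p q e :: "'a::{real_normed_algebra_1,banach}"
  assumes pN: "p ^ N = q + \<delta> *\<^sub>R e" and N: "N > 0" and \<delta>: "\<delta> \<noteq> 0"
    and pe: "p * e = e" and ee: "e * e = e"
    and q: "summable (\<lambda>n. norm (q ^ n))"
  obtains \<pi> where "\<pi> * p = \<pi>" "p * \<pi> = \<pi>" "\<pi> * \<pi> = \<pi>" "\<pi> * e = e" "e * \<pi> = \<pi>"
    "summable (\<lambda>k. norm ((p - \<pi>) ^ k))"
proof -
  define G where "G = (\<Sum>n. q ^ n)"
  note G = geometric_resolvent[OF q, folded G_def]
  have pne: "p ^ n * e = e" for n by (induction n) (simp_all add: mult.assoc pe)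
  have "q * e = (1 - \<delta>) *\<^sub>R e"
    using arg_cong[OF pN, of "\<lambda>x. x * e"] by (simp add: pne ee algebra_simps)
  then have "(1 - q) * e = \<delta> *\<^sub>R e" by (simp add: algebra_simps)
  then have Ge: "\<delta> *\<^sub>R (G * e) = e"
    using arg_cong[OF G(2), of "\<lambda>x. x * e"] by (simp add: mult.assoc)
  define \<pi> where "\<pi> = \<delta> *\<^sub>R (e * G)"
  have \<pi>e: "\<pi> * e = e"
  proof -
    have "\<pi> * e = e * (\<delta> *\<^sub>R (G * e))" by (simp add: \<pi>_def mult.assoc)
    then show ?thesis by (simp only: Ge ee)
  qed
  have e\<pi>: "e * \<pi> = \<pi>" by (simp add: \<pi>_def mult.assoc[symmetric] ee)
  have p\<pi>: "p * \<pi> = \<pi>" by (simp add: \<pi>_def mult.assoc[symmetric] pe)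
  have \<pi>\<pi>: "\<pi> * \<pi> = \<pi>"
    by (metis \<pi>e e\<pi> mult.assoc)
  have "\<pi> * (1 - q) = \<delta> *\<^sub>R e" by (simp add: \<pi>_def mult.assoc G)
  then have \<pi>pN: "\<pi> * p ^ N = \<pi>"
    by (simp add: pN distrib_left \<pi>e algebra_simps)
  \<comment> \<open>Invariance under \<open>p ^ N\<close> is upgraded to invariance under
    \<open>p\<close>: the defect \<open>\<pi> * p - \<pi>\<close> is fixed by right multiplication
    with \<open>p ^ N\<close> and annihilates \<open>e\<close>, so \<open>q\<close> fixes it too,
    and invertibility of \<open>1 - q\<close> makes it zero.\<close>
  have "(\<pi> * p - \<pi>) * e = 0" by (simp add: left_diff_distrib mult.assoc pe \<pi>e)
  then have "(\<pi> * p - \<pi>) * p ^ N = (\<pi> * p - \<pi>) * q"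
    by (simp add: pN distrib_left)
  moreover have "(\<pi> * p - \<pi>) * p ^ N = \<pi> * p - \<pi>"
    by (simp add: left_diff_distrib \<pi>pN) (metis \<pi>pN mult.assoc power_commutes)
  ultimately have "(\<pi> * p - \<pi>) * (1 - q) = 0" by (simp add: right_diff_distrib)
  then have "(\<pi> * p - \<pi>) * ((1 - q) * G) = 0" by (simp only: mult.assoc[symmetric] mult_zero_left)
  then have \<pi>p: "\<pi> * p = \<pi>" by (simp add: G)
  have T: "(p - \<pi>) ^ n = p ^ n - \<pi>" if "n > 0" for n
    using that
  proof (induction n)
    case (Suc n)
    have pn\<pi>: "p ^ n * \<pi> = \<pi>" by (induction n) (simp_all add: mult.assoc p\<pi>)
    show ?case
    proof (cases "n = 0")
      case False
      then have "(p - \<pi>) ^ Suc n = (p ^ n - \<pi>) * (p - \<pi>)"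
        using Suc by (simp add: power_Suc2 del: power_Suc)
      then show ?thesis by (simp add: algebra_simps pn\<pi> \<pi>p \<pi>\<pi> power_commutes)
    qed simp
  qed simp
  \<comment> \<open>Each factor \<open>p ^ N\<close> commutes with \<open>1 - \<pi>\<close>, which
    annihilates its part \<open>\<delta> *\<^sub>R e\<close>, so only \<open>q\<close>
    survives.\<close>
  have Q: "p ^ (N * n) * (1 - \<pi>) = (1 - \<pi>) * q ^ n" for n
  proof (induction n)
    case (Suc n)
    have c: "(1 - \<pi>) * p ^ N = p ^ N * (1 - \<pi>)"
    proof -
      have "p ^ N * \<pi> = \<pi>" for N by (induction N) (simp_all add: mult.assoc p\<pi>)
      then show ?thesis by (simp add: algebra_simps \<pi>pN)
    qed
    have "p ^ (N * Suc n) * (1 - \<pi>) = p ^ (N * n) * (p ^ N * (1 - \<pi>))"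
      by (simp add: power_add[symmetric] mult.assoc[symmetric] add.commute)
    also have "\<dots> = p ^ (N * n) * (1 - \<pi>) * p ^ N" by (simp add: c mult.assoc)
    also have "\<dots> = (p ^ (N * n) * (1 - \<pi>)) * q + p ^ (N * n) * ((1 - \<pi>) * e) * 1"
      using \<pi>e by (simp add: pN distrib_left mult.assoc left_diff_distrib)
    also have "\<dots> = (1 - \<pi>) * q ^ Suc n"
      using \<pi>e by (simp add: Suc.IH left_diff_distrib mult.assoc power_commutes)
    finally show ?case .
  qed simp
  have "(\<lambda>n. norm (1 - \<pi>) * norm (q ^ n)) \<longlonglongrightarrow> norm (1 - \<pi>) * 0"
    by (intro tendsto_intros summable_LIMSEQ_zero q)
  then have "eventually (\<lambda>n. norm (1 - \<pi>) * norm (q ^ n) < 1) sequentially"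
    by (rule order_tendstoD(2)) simp
  then obtain n0 where n0: "\<And>n. n \<ge> n0 \<Longrightarrow> norm (1 - \<pi>) * norm (q ^ n) < 1"
    by (auto simp: eventually_sequentially)
  \<comment> \<open>The successor keeps the exponent positive, as \<open>T\<close> requires.\<close>
  let ?n = "Suc n0"
  have "(p - \<pi>) ^ (N * ?n) = p ^ (N * ?n) * (1 - \<pi>)"
  proof -
    have "p ^ k * \<pi> = \<pi>" for k by (induction k) (simp_all add: mult.assoc p\<pi>)
    moreover have "0 < N * ?n" using N by simp
    ultimately show ?thesis by (simp only: T right_diff_distrib mult_1_right)
  qed
  then have "norm ((p - \<pi>) ^ (N * ?n)) < 1"
    using n0[of ?n] norm_mult_ineq[of "1 - \<pi>" "q ^ ?n"] by (simp only: Q) linarith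
  then have "summable (\<lambda>k. norm ((p - \<pi>) ^ k))" by (rule summable_norm_power)
  with \<pi>p p\<pi> \<pi>\<pi> \<pi>e e\<pi> show ?thesis by (rule that)
qed

text \<open>The matrix \<open>p + m * (1 - (p - \<pi>))\<close> is the perturbed one when
  \<open>m\<close> is the perturbation times the fundamental matrix. The condition
  \<open>m * e = 0\<close> says that the perturbation has zero row sums, so \<open>\<pi> * H\<close>
  keeps total mass \<open>1\<close>.\<close>

lemma perturbed_projection:
  fixes p \<pi> e m :: "'a::{real_normed_algebra_1,banach}"
  assumes \<pi>p: "\<pi> * p = \<pi>" and \<pi>\<pi>: "\<pi> * \<pi> = \<pi>" and \<pi>e: "\<pi> * e = e" and e\<pi>: "e * \<pi> = \<pi>"
    and m: "norm m < 1" and me: "m * e = 0"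
  obtains \<nu> r where "\<nu> * (p + m * (1 - (p - \<pi>))) = \<nu>" "\<nu> * e = e" "e * \<nu> = \<nu>"
    "\<nu> = \<pi> + \<pi> * m + \<pi> * r" "norm r \<le> (norm m)\<^sup>2 / (1 - norm m)"
proof -
  define H where "H = (\<Sum>k. m ^ k)"
  have "summable (\<lambda>k. norm (m ^ k))" by (rule summable_norm_power[of m 1]) (simp add: m)
  note H = geometric_resolvent[OF this, folded H_def]
  have Hm: "H = 1 + H * m" using H(2) by (simp add: algebra_simps)
  have He: "H * e = e" by (subst Hm) (simp add: distrib_right mult.assoc me)
  define \<nu> where "\<nu> = \<pi> * H"
  have \<nu>e: "\<nu> * e = e" by (simp add: \<nu>_def mult.assoc He \<pi>e)
  have e\<nu>: "e * \<nu> = \<nu>" by (simp add: \<nu>_def mult.assoc[symmetric] e\<pi>)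
  have \<nu>\<pi>: "\<nu> * \<pi> = \<pi>" by (metis \<nu>e e\<pi> mult.assoc)
  have \<nu>m: "\<nu> * m = \<nu> - \<pi>"
  proof -
    have "H * m = H - 1" using Hm by (metis add_diff_cancel_left')
    then show ?thesis by (simp add: \<nu>_def mult.assoc right_diff_distrib)
  qed
  \<comment> \<open>Since \<open>\<nu> * m = \<nu> - \<pi>\<close>, the terms
    \<open>\<nu> * p\<close> cancel; the rest apart from \<open>\<nu>\<close> reduces to copies of
    \<open>\<pi>\<close> that cancel as well.\<close>
  have 1: "\<nu> * (p + m * (1 - (p - \<pi>))) = \<nu>"
    by (simp add: distrib_left mult.assoc[symmetric] \<nu>m) (simp add: algebra_simps \<nu>\<pi> \<pi>\<pi> \<pi>p)
  \<comment> \<open>Unfolding the Neumann series twice isolates the second-order remainder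
    \<open>H * m * m\<close>.\<close>
  have "H * m = m + H * m * m"
    using arg_cong[OF Hm, of "\<lambda>x. x * m"] by (simp add: distrib_right)
  with Hm have "H = 1 + m + H * m * m" by (metis add.assoc)
  then have "\<nu> = \<pi> * (1 + m + H * m * m)" by (simp only: \<nu>_def)
  then have 2: "\<nu> = \<pi> + \<pi> * m + \<pi> * (H * m * m)" by (simp only: distrib_left mult_1_right)
  have "norm (H * m * m) \<le> norm (H * m) * norm m" by (rule norm_mult_ineq)
  also have "\<dots> \<le> norm H * norm m * norm m" by (intro mult_right_mono norm_mult_ineq norm_ge_zero)
  also have "\<dots> \<le> (1 / (1 - norm m)) * norm m * norm m"
    unfolding H_def by (intro mult_right_mono norm_geometric_le m norm_ge_zero)
  finally have "norm (H * m * m) \<le> (norm m)\<^sup>2 / (1 - norm m)"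
    by (simp add: power2_eq_square)
  with 1 \<nu>e e\<nu> 2 show ?thesis by (rule that)
qed

section \<open>Minorization and drift\<close>

text \<open>The least positive difference \<open>d\<close> of two elements divides every element, so
  \<open>d = 1\<close> and \<open>S\<close> contains some \<open>a\<close> and \<open>a + 1\<close>.
  For \<open>n \<ge> a * a\<close> the remainder modulo \<open>a\<close> does not exceed the
  quotient, so that many copies of \<open>a\<close> can be exchanged for
  \<open>a + 1\<close>.\<close>

lemma additive_nat_set_contains_all_large:
  fixes S :: "nat set"
  assumes 0: "0 \<in> S" and add: "\<And>a b. a \<in> S \<Longrightarrow> b \<in> S \<Longrightarrow> a + b \<in> S"
    and gcd: "\<And>d. (\<And>s. s \<in> S \<Longrightarrow> d dvd s) \<Longrightarrow> d = 1"
  obtains n0 where "\<And>n. n \<ge> n0 \<Longrightarrow> n \<in> S"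
proof -
  have mul: "k * a \<in> S" if "a \<in> S" for k a
    using that by (induction k) (auto intro: 0 add)
  let ?D = "\<lambda>d. d > 0 \<and> (\<exists>a\<in>S. a + d \<in> S)"
  have "\<exists>s\<in>S. s \<noteq> 0"
  proof (rule ccontr)
    assume "\<not> (\<exists>s\<in>S. s \<noteq> 0)"
    then have "(0::nat) = 1" by (intro gcd) auto
    then show False by simp
  qed
  then obtain s where "s \<in> S" "s \<noteq> 0" by blast
  then have ex: "?D s" using 0 by (auto intro!: bexI[of _ 0])
  define d where "d = (LEAST d. ?D d)"
  have d: "?D d" unfolding d_def by (rule LeastI[of ?D, OF ex])
  have least: "d \<le> r" if "?D r" for r unfolding d_def by (rule Least_le) (rule that)
  from d obtain a where a: "d > 0" "a \<in> S" "a + d \<in> S" by blast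
  have "d dvd m" if m: "m \<in> S" for m
  proof (rule ccontr)
    assume "\<not> d dvd m"
    then have r: "m mod d > 0" by (simp add: dvd_eq_mod_eq_0)
    \<comment> \<open>The remainder is again a difference of two elements of \<open>S\<close>,
      contradicting minimality of \<open>d\<close>.\<close>
    have "(m div d) * (a + d) + m mod d = m + (m div d) * a"
      using div_mult_mod_eq[of m d] by (simp add: algebra_simps)
    moreover have "m + (m div d) * a \<in> S" by (intro add mul a m)
    moreover have "(m div d) * (a + d) \<in> S" by (intro mul a)
    ultimately have "?D (m mod d)" using r by metis
    from least[OF this] show False using mod_less_divisor[OF a(1), of m] by linarith
  qed
  from gcd[OF this] have d1: "d = 1" .
  show ?thesis
  proof (rule that[of "a * a"])
    fix n assume n: "n \<ge> a * a"
    show "n \<in> S"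
    proof (cases "a = 0")
      case True
      then show ?thesis using mul[OF a(3), of n] by (simp add: d1)
    next
      case False
      then have le: "n mod a \<le> n div a"
        using n by (metis bot_nat_0.not_eq_extremum div_le_mono le_trans less_imp_le mod_less_divisor nonzero_mult_div_cancel_right)
      have "n = (n div a - n mod a) * a + (n mod a) * (a + 1)"
        using le div_mult_mod_eq[of n a] by (simp add: algebra_simps diff_mult_distrib)
      then show ?thesis using add[OF mul mul] a d1 by metis
    qed
  qed
qed

section \<open>Chains with finitely supported rows\<close>

locale finite_chain =
  fixes M :: "'x \<Rightarrow> 'x \<Rightarrow> real"
  assumes nonneg: "0 \<le> M x y"
    and finite_support: "finite {y. M x y \<noteq> 0}"
    and support_sum: "(\<Sum>y | M x y \<noteq> 0. M x y) = 1"
begin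

text \<open>Finite support turns the action on arbitrary functions into a finite sum, so the order
  and linearity facts below carry no summability conditions.\<close>

lemma mat_vec_finite: "mat_vec M f x = (\<Sum>y | M x y \<noteq> 0. M x y * f y)"
  unfolding mat_vec_def
  using infsum_cong_neutral[of "{y. M x y \<noteq> 0}" UNIV "\<lambda>y. M x y * f y" "\<lambda>y. M x y * f y"] finite_support
  by simp

lemma mat_mult_eq_mat_vec: "mat_mult M L x y = mat_vec M (\<lambda>z. L z y) x"
  by (simp add: mat_mult_def mat_vec_def)

lemma mat_vec_mono: "(\<And>y. f y \<le> g y) \<Longrightarrow> mat_vec M f x \<le> mat_vec M g x"
  unfolding mat_vec_finite by (intro sum_mono mult_left_mono nonneg)

lemma mat_vec_affine: "mat_vec M (\<lambda>y. a * f y + c) x = a * mat_vec M f x + c"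
  by (simp add: mat_vec_finite distrib_left sum.distrib sum_distrib_left sum_distrib_right[symmetric]
      support_sum mult.left_commute)

lemma mat_vec_cmult: "mat_vec M (\<lambda>y. a * f y) x = a * mat_vec M f x"
  using mat_vec_affine[of a f 0] by simp

lemma has_sum_row: "((\<lambda>y. M x y * f y) has_sum mat_vec M f x) UNIV"
  unfolding mat_vec_finite
  using has_sum_cong_neutral[of "{y. M x y \<noteq> 0}" UNIV "\<lambda>y. M x y * f y" "\<lambda>y. M x y * f y"]
    has_sum_finite[OF finite_support] by force

lemma has_sum_mat_mult:
  assumes "\<And>z. ((\<lambda>y. L z y * f y) has_sum F z) UNIV"
  shows "((\<lambda>y. mat_mult M L x y * f y) has_sum mat_vec M F x) UNIV"
  unfolding mat_mult_eq_mat_vec mat_vec_finite sum_distrib_right mult.assoc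
  by (intro has_sum_finite_sum has_sum_cmult_right assms)

lemma mat_pow_nonneg: "0 \<le> mat_pow M n x y"
proof (induction n arbitrary: x)
  case (Suc n)
  then show ?case by (simp add: mat_mult_eq_mat_vec mat_vec_finite sum_nonneg nonneg)
qed simp

lemma has_sum_mat_pow: "((\<lambda>y. mat_pow M n x y * f y) has_sum (mat_vec M ^^ n) f x) UNIV"
proof (induction n arbitrary: x)
  case 0
  show ?case
    using has_sum_cong_neutral[of "{x}" UNIV f "\<lambda>y. mat_pow M 0 x y * f y" "f x"] has_sum_finite[of "{x}" f]
    by simp
next
  case (Suc n)
  then show ?case by (simp add: has_sum_mat_mult)
qed

lemma mat_pow_row_sum: "(mat_pow M n x has_sum 1) UNIV"
proof -
  have 1: "(mat_vec M ^^ n) (\<lambda>_. 1) = (\<lambda>_. 1)"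
    by (induction n) (use mat_vec_affine[of 0 _ 1] in auto)
  show ?thesis using has_sum_mat_pow[of n x "\<lambda>_. 1"] by (simp add: 1)
qed

text \<open>One half of Chapman-Kolmogorov: only paths passing through \<open>y\<close> at time
  \<open>m\<close> are counted.\<close>

lemma mat_pow_add_ge: "mat_pow M m x y * mat_pow M n y z \<le> mat_pow M (m + n) x z"
proof (induction m arbitrary: x)
  case 0
  then show ?case using mat_pow_nonneg[of n] by auto
next
  case (Suc m)
  have "mat_pow M (Suc m) x y * mat_pow M n y z = mat_vec M (\<lambda>w. mat_pow M n y z * mat_pow M m w y) x"
    by (simp add: mat_mult_eq_mat_vec mat_vec_cmult)
  also have "\<dots> \<le> mat_vec M (\<lambda>w. mat_pow M (m + n) w z) x"
    using Suc.IH by (intro mat_vec_mono) (simp add: mult.commute)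
  finally show ?case by (simp add: mat_mult_eq_mat_vec)
qed

text \<open>The possible return times to \<open>z\<close> are closed under addition and have
  greatest common divisor \<open>1\<close>, hence contain all large times; a path from
  \<open>x\<close> to \<open>z\<close> is put in front.\<close>

lemma mat_pow_eventually_pos:
  assumes irr: "irreducible_chain M" and ap: "aperiodic_chain M"
  shows "\<exists>K. \<forall>k\<ge>K. 0 < mat_pow M k x z"
proof -
  obtain n0 where n0: "\<And>n. n \<ge> n0 \<Longrightarrow> n \<in> {n. 0 < mat_pow M n z z}"
  proof (rule additive_nat_set_contains_all_large)
    show "0 \<in> {n. 0 < mat_pow M n z z}" by simp
    show "a + b \<in> {n. 0 < mat_pow M n z z}" if "a \<in> {n. 0 < mat_pow M n z z}" "b \<in> {n. 0 < mat_pow M n z z}" for a b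
      using that mat_pow_add_ge[of a z z b z] by (auto intro: less_le_trans[OF mult_pos_pos])
    show "d = 1" if "\<And>s. s \<in> {n. 0 < mat_pow M n z z} \<Longrightarrow> d dvd s" for d
    proof -
      have "d dvd Gcd {n. n > 0 \<and> mat_pow M n z z > 0}"
        by (rule Gcd_greatest) (use that in auto)
      then show ?thesis using ap by (simp add: aperiodic_chain_def)
    qed
  qed blast
  obtain m where m: "0 < mat_pow M m x z" using irr by (auto simp: irreducible_chain_def)
  have "0 < mat_pow M k x z" if "k \<ge> m + n0" for k
  proof -
    have "0 < mat_pow M (k - m) z z" using n0[of "k - m"] that by simp
    from mult_pos_pos[OF m this] show ?thesis
      using mat_pow_add_ge[of m x z "k - m" z] that by simp
  qed
  then show ?thesis by blast
qed

end

section \<open>Iterated drift, minorization and contraction\<close>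

locale weighted_chain = finite_chain M + weight V
  for M :: "'x \<Rightarrow> 'x \<Rightarrow> real" and V :: "'x \<Rightarrow> real" +
  assumes V_ge_1: "1 \<le> V x"
    and irreducible: "irreducible_chain M"

locale drift_chain = weighted_chain M V
  for M :: "'x \<Rightarrow> 'x \<Rightarrow> real" and V :: "'x \<Rightarrow> real" +
  fixes \<epsilon> b :: real and C :: "'x set"
  assumes drift: "drift_condition M V \<epsilon> b C"
    and aperiodic: "aperiodic_chain M"
begin

lemma drift_facts:
  shows \<epsilon>: "0 < \<epsilon>" "\<epsilon> < 1" and b: "0 \<le> b" and finite_C: "finite C"
    and drift_le: "mat_vec M V x \<le> \<epsilon> * V x + b * indicat_real C x"
  using drift by (auto simp: drift_condition_def)

lemma drift_le_b: "mat_vec M V x \<le> \<epsilon> * V x + b"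
  using drift_le[of x] b by (cases "x \<in> C") auto

lemma mat_pow_drift: "(mat_vec M ^^ n) V x \<le> \<epsilon> ^ n * V x + b / (1 - \<epsilon>)"
proof -
  have "(mat_vec M ^^ n) V x \<le> \<epsilon> ^ n * V x + b * (\<Sum>k<n. \<epsilon> ^ k)"
  proof (induction n arbitrary: x)
    case (Suc n)
    have "(mat_vec M ^^ Suc n) V x \<le> mat_vec M (\<lambda>y. \<epsilon> ^ n * V y + b * (\<Sum>k<n. \<epsilon> ^ k)) x"
      using Suc.IH by (auto intro: mat_vec_mono)
    also have "\<dots> \<le> \<epsilon> ^ n * (\<epsilon> * V x + b) + b * (\<Sum>k<n. \<epsilon> ^ k)"
      unfolding mat_vec_affine using drift_le_b[of x] \<epsilon> by (intro add_right_mono mult_left_mono) auto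
    finally show ?case by (simp add: algebra_simps)
  qed simp
  moreover have "(\<Sum>k<n. \<epsilon> ^ k) \<le> 1 / (1 - \<epsilon>)"
    using \<epsilon> sum_le_suminf[of "\<lambda>k. \<epsilon> ^ k" "{..<n}"] by (simp add: suminf_geometric summable_geometric)
  from mult_left_mono[OF this b] have "b * (\<Sum>k<n. \<epsilon> ^ k) \<le> b / (1 - \<epsilon>)" by simp
  ultimately show ?thesis by linarith
qed

text \<open>By the drift, the chain started at \<open>x\<close> misses \<open>C\<close> for \<open>n\<close> steps with probability at most
  \<open>\<epsilon>\<^sup>n V x\<close>; once in \<open>C\<close>, it reaches \<open>z\<close> at the prescribed time with probability at least \<open>\<delta>\<close>.\<close>

lemma hitting_lower_bound:
  assumes "0 \<le> \<delta>" "\<And>c k. c \<in> C \<Longrightarrow> K \<le> k \<Longrightarrow> k \<le> K + n \<Longrightarrow> \<delta> \<le> mat_pow M k c z"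
  shows "\<delta> * (1 - \<epsilon> ^ n * V x) \<le> mat_pow M (K + n) x z"
  using assms(2)
proof (induction n arbitrary: x)
  case 0
  \<comment> \<open>Without any step left the bound is trivial, because \<open>V\<close> is at least
    \<open>1\<close>.\<close>
  have "\<delta> * (1 - V x) \<le> 0" using V_ge_1[of x] assms(1) by (simp add: mult_nonneg_nonpos)
  then show ?case using mat_pow_nonneg[of K x z] by simp
next
  case (Suc n)
  show ?case
  proof (cases "x \<in> C")
    case True
    have "\<delta> * (1 - \<epsilon> ^ Suc n * V x) \<le> \<delta> * 1"
      using \<epsilon> pos[of x] assms(1) by (intro mult_left_mono) auto
    also have "\<dots> \<le> mat_pow M (K + Suc n) x z" using Suc.prems[of x "K + Suc n"] True by simp
    finally show ?thesis .
  next
    case False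
    have "mat_vec M V x \<le> \<epsilon> * V x" using drift_le[of x] False by simp
    then have "\<delta> * \<epsilon> ^ n * mat_vec M V x \<le> \<delta> * \<epsilon> ^ n * (\<epsilon> * V x)"
      using \<epsilon> assms(1) by (intro mult_left_mono) auto
    then have "\<delta> * (1 - \<epsilon> ^ Suc n * V x) \<le> (- \<delta> * \<epsilon> ^ n) * mat_vec M V x + \<delta>"
      by (simp add: algebra_simps)
    also have "\<dots> = mat_vec M (\<lambda>y. (- \<delta> * \<epsilon> ^ n) * V y + \<delta>) x"
      by (rule mat_vec_affine[symmetric])
    also have "\<dots> \<le> mat_vec M (\<lambda>y. mat_pow M (K + n) y z) x"
      using Suc.IH[OF Suc.prems] by (intro mat_vec_mono) (simp add: algebra_simps)
    finally show ?thesis by (simp add: mat_mult_eq_mat_vec)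
  qed
qed

text \<open>Sublevel sets of \<open>V\<close> may be infinite, so the minimum is taken over the
  finite set \<open>C\<close> and a finite window of times instead. Within \<open>n\<close> steps
  \<open>C\<close> is reached from the whole sublevel set with probability at least one
  half.\<close>

lemma sublevel_minorization:
  obtains N \<delta> where "0 < N" "0 < \<delta>" "\<And>x. V x \<le> R \<Longrightarrow> \<delta> \<le> mat_pow M N x z"
proof -
  \<comment> \<open>Chosen so that \<open>\<epsilon> ^ n * V x\<close> is at most
    \<open>1 / 2\<close> when \<open>V x \<le> R\<close>; \<open>max R 1\<close> keeps the
    denominator positive.\<close>
  obtain n where n: "\<epsilon> ^ n < 1 / (2 * max R 1)"
    using real_arch_pow_inv[of "1 / (2 * max R 1)" \<epsilon>] \<epsilon> by auto
  have "\<forall>c. \<exists>K. \<forall>k\<ge>K. 0 < mat_pow M k c z"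
    using mat_pow_eventually_pos[OF irreducible aperiodic] by blast
  then obtain K where K: "\<And>c k. k \<ge> K c \<Longrightarrow> 0 < mat_pow M k c z" by metis
  define K0 where "K0 = Suc (sum K C)"
  have K0: "0 < mat_pow M k c z" if "c \<in> C" "K0 \<le> k" for c k
    using member_le_sum[of c C K] finite_C that by (intro K) (auto simp: K0_def)
  \<comment> \<open>Inserting \<open>1\<close> keeps the set nonempty when \<open>C\<close> is
    empty.\<close>
  define A where "A = insert 1 ((\<lambda>(c, k). mat_pow M k c z) ` (C \<times> {K0..K0 + n}))"
  have A: "finite A" "A \<noteq> {}" "\<And>a. a \<in> A \<Longrightarrow> 0 < a"
    using finite_C K0 by (auto simp: A_def)
  define \<delta> where "\<delta> = Min A"
  have \<delta>: "0 < \<delta>" using A Min_in[of A] by (simp add: \<delta>_def)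
  have \<delta>_le: "\<delta> \<le> mat_pow M k c z" if "c \<in> C" "K0 \<le> k" "k \<le> K0 + n" for c k
    unfolding \<delta>_def using that A by (intro Min_le) (auto simp: A_def)
  show ?thesis
  proof (rule that[of "K0 + n" "\<delta> / 2"])
    fix x assume x: "V x \<le> R"
    have "\<epsilon> ^ n * V x \<le> (1 / (2 * max R 1)) * max R 1"
      using n x \<epsilon> pos[of x] by (intro mult_mono) auto
    then have "\<epsilon> ^ n * V x \<le> 1 / 2" by (simp add: field_simps)
    then have "\<delta> * (1 / 2) \<le> \<delta> * (1 - \<epsilon> ^ n * V x)" using \<delta> by (intro mult_left_mono) auto
    also have "\<dots> \<le> mat_pow M (K0 + n) x z"
      by (rule hitting_lower_bound) (use \<delta> \<delta>_le in auto)
    finally show "\<delta> / 2 \<le> mat_pow M (K0 + n) x z" by simp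
  qed (use \<delta> in \<open>auto simp: K0_def\<close>)
qed

text \<open>Subtracting \<open>\<delta>\<close> from the \<open>z\<close>-column of \<open>M\<^sup>N\<close> gives a strict contraction for the weight
  \<open>1 + \<beta> V\<close>: where \<open>V\<close> is small the subtraction removes mass, and where \<open>V\<close> is large the drift
  compensates the at most \<open>2 \<delta>\<close> by which taking absolute values overshoots.\<close>

lemma minorized_power_contraction:
  obtains N \<delta> \<beta> \<alpha> where "0 < N" "0 < \<delta>" "0 < \<beta>" "0 \<le> \<alpha>" "\<alpha> < 1"
    "\<And>x F. finite F \<Longrightarrow> (\<Sum>y\<in>F. \<bar>mat_pow M N x y - (if y = z then \<delta> else 0)\<bar> * (1 + \<beta> * V y))
        \<le> \<alpha> * (1 + \<beta> * V x)"
proof -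
  define B where "B = b / (1 - \<epsilon>) + 1"
  have B: "1 \<le> B" using b \<epsilon> by (simp add: B_def)
  \<comment> \<open>Large enough that \<open>(4 * B + 2) / R\<close>, the relative cost of the
    overshoot, stays below \<open>1 - \<epsilon>\<close>.\<close>
  define R where "R = (4 * B + 3) / (1 - \<epsilon>)"
  have R: "0 < R" using B \<epsilon> by (simp add: R_def)
  obtain N \<delta>\<^sub>0 where N: "0 < N" and \<delta>\<^sub>0: "0 < \<delta>\<^sub>0" "\<And>x. V x \<le> R \<Longrightarrow> \<delta>\<^sub>0 \<le> mat_pow M N x z"
    by (rule sublevel_minorization[of R z]) (rule that; assumption)
  \<comment> \<open>The cap \<open>1 / V z\<close> keeps the new weight at \<open>z\<close> below
    \<open>1 + 1 / (2 * B)\<close>.\<close>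
  define \<delta> where "\<delta> = min \<delta>\<^sub>0 (1 / V z)"
  have \<delta>: "0 < \<delta>" "\<delta> \<le> \<delta>\<^sub>0" "\<delta> * V z \<le> 1"
    using \<delta>\<^sub>0 pos[of z] by (auto simp: \<delta>_def min_def field_simps)
  \<comment> \<open>With \<open>\<beta> * B = \<delta> / 2\<close>, half of the subtracted mass pays
    for the additive constant of the drift.\<close>
  define \<beta> where "\<beta> = \<delta> / (2 * B)"
  have \<beta>: "0 < \<beta>" "\<beta> * B = \<delta> / 2" using \<delta> B by (auto simp: \<beta>_def)
  define \<gamma> where "\<gamma> = \<epsilon> + (4 * B + 2) / R"
  have "(4 * B + 2) / R = (1 - \<epsilon>) * ((4 * B + 2) / (4 * B + 3))" by (simp add: R_def)
  also have "\<dots> < (1 - \<epsilon>) * 1" using B \<epsilon> by (intro mult_strict_left_mono) auto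
  finally have \<gamma>: "\<gamma> < 1" "0 < \<gamma>" using B R \<epsilon> by (auto simp: \<gamma>_def intro!: add_pos_pos divide_pos_pos)
  define \<alpha> where "\<alpha> = max (1 - \<delta> / 2) \<gamma>"
  have \<alpha>: "0 \<le> \<alpha>" "\<alpha> < 1" using \<gamma> \<delta> by (auto simp: \<alpha>_def)
  let ?W = "\<lambda>y. 1 + \<beta> * V y"
  have W: "0 < ?W y" for y using \<beta> pos[of y] by (simp add: add_pos_pos)
  have Wz: "1 \<le> ?W z" "?W z \<le> 1 + 1 / (2 * B)"
  proof -
    show "1 \<le> ?W z" using \<beta> pos[of z] by simp
    have "\<beta> * V z = (\<delta> * V z) / (2 * B)" by (simp add: \<beta>_def)
    also have "\<dots> \<le> 1 / (2 * B)" using \<delta> B by (intro divide_right_mono) auto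
    finally show "?W z \<le> 1 + 1 / (2 * B)" by simp
  qed
  have "(\<Sum>y\<in>F. \<bar>mat_pow M N x y - (if y = z then \<delta> else 0)\<bar> * ?W y) \<le> \<alpha> * ?W x"
    if "finite F" for x F
  proof -
    \<comment> \<open>This correction covers both regimes: for \<open>V x \<le> R\<close> no
      overshoot occurs, and otherwise \<open>2 * \<delta>\<close> is at most
      \<open>2 * \<delta> * V x / R\<close>.\<close>
    let ?c = "2 * \<delta> * V x / R - \<delta>"
    have z: "\<bar>mat_pow M N x z - \<delta>\<bar> \<le> mat_pow M N x z + ?c"
    proof (cases "V x \<le> R")
      case True
      then have "\<delta> \<le> mat_pow M N x z" using \<delta>\<^sub>0(2) \<delta> by force
      then show ?thesis using \<delta> pos[of x] R by simp
    next
      case False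
      then have "2 * \<delta> * 1 \<le> 2 * \<delta> * (V x / R)" using R \<delta> by (intro mult_left_mono) auto
      then show ?thesis using \<delta> mat_pow_nonneg[of N x z] by (simp add: abs_le_iff)
    qed
    \<comment> \<open>Enlarging \<open>F\<close> by \<open>z\<close> only increases the sum and
      ensures that the \<open>?c\<close> term, which carries the gain \<open>-\<delta>\<close>, is
      present.\<close>
    have "(\<Sum>y\<in>F. \<bar>mat_pow M N x y - (if y = z then \<delta> else 0)\<bar> * ?W y)
        \<le> (\<Sum>y\<in>insert z F. \<bar>mat_pow M N x y - (if y = z then \<delta> else 0)\<bar> * ?W y)"
      using that W by (intro sum_mono2) (auto intro!: mult_nonneg_nonneg less_imp_le[OF W])
    also have "\<dots> \<le> (\<Sum>y\<in>insert z F. mat_pow M N x y * ?W y + (if y = z then ?c * ?W z else 0))"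
    proof (rule sum_mono)
      fix y
      show "\<bar>mat_pow M N x y - (if y = z then \<delta> else 0)\<bar> * ?W y
          \<le> mat_pow M N x y * ?W y + (if y = z then ?c * ?W z else 0)"
        using mult_right_mono[OF z less_imp_le[OF W[of z]]] mat_pow_nonneg[of N x y]
        by (auto simp: distrib_right)
    qed
    also have "\<dots> = (\<Sum>y\<in>insert z F. mat_pow M N x y * ?W y) + ?c * ?W z"
      using that by (simp add: sum.distrib)
    also have "(\<Sum>y\<in>insert z F. mat_pow M N x y * ?W y) \<le> 1 + \<beta> * (\<epsilon> * V x + B)"
    proof -
      have hs: "((\<lambda>y. mat_pow M N x y + \<beta> * (mat_pow M N x y * V y)) has_sum 1 + \<beta> * (mat_vec M ^^ N) V x) UNIV"
        by (intro has_sum_add has_sum_cmult_right mat_pow_row_sum has_sum_mat_pow)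
      have "(\<Sum>y\<in>insert z F. mat_pow M N x y + \<beta> * (mat_pow M N x y * V y)) \<le> 1 + \<beta> * (mat_vec M ^^ N) V x"
        by (rule finite_sum_le_has_sum[OF hs])
           (use that \<beta> in \<open>auto intro!: add_nonneg_nonneg mult_nonneg_nonneg mat_pow_nonneg less_imp_le[OF pos]\<close>)
      also have "\<epsilon> ^ N * V x \<le> \<epsilon> * V x"
        using N \<epsilon> power_decreasing[of 1 N \<epsilon>] pos[of x] by (intro mult_right_mono) auto
      then have "(mat_vec M ^^ N) V x \<le> \<epsilon> * V x + B"
        using mat_pow_drift[of N x] by (simp add: B_def)
      then have "1 + \<beta> * (mat_vec M ^^ N) V x \<le> 1 + \<beta> * (\<epsilon> * V x + B)"
        using \<beta> by (intro add_left_mono mult_left_mono) auto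
      finally show ?thesis by (simp add: algebra_simps)
    qed
    also have "?c * ?W z \<le> (2 * \<delta> * V x / R) * (1 + 1 / (2 * B)) - \<delta>"
    proof -
      have "(2 * \<delta> * V x / R) * ?W z \<le> (2 * \<delta> * V x / R) * (1 + 1 / (2 * B))"
        using Wz \<delta> R pos[of x] by (intro mult_left_mono) auto
      moreover have "\<delta> * 1 \<le> \<delta> * ?W z" using Wz \<delta> by (intro mult_left_mono) auto
      ultimately show ?thesis by (simp add: left_diff_distrib)
    qed
    also have "(2 * \<delta> * V x / R) * (1 + 1 / (2 * B)) = \<beta> * V x * ((4 * B + 2) / R)"
      using B R by (simp add: \<beta>_def field_simps)
    also have "1 + \<beta> * (\<epsilon> * V x + B) + (\<beta> * V x * ((4 * B + 2) / R) - \<delta>)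
        = (1 - \<delta> / 2) + \<gamma> * (\<beta> * V x)"
      using \<beta>(2) by (simp add: \<gamma>_def algebra_simps)
    also have "\<dots> \<le> \<alpha> * 1 + \<alpha> * (\<beta> * V x)"
      using \<beta> pos[of x] by (intro add_mono mult_right_mono) (auto simp: \<alpha>_def)
    finally show ?thesis by (simp add: algebra_simps)
  qed
  with N \<delta>(1) \<beta>(1) \<alpha> show ?thesis by (rule that)
qed

text \<open>The weights \<open>V\<close> and \<open>1 + \<beta> * V\<close> are equivalent because
  \<open>V\<close> is at least \<open>1\<close>, so geometric decay for the second gives decay for
  the first up to the factor \<open>(1 + \<beta>) / \<beta>\<close>.\<close>

lemma minorized_power_summable:
  obtains N \<delta> where "0 < N" "0 < \<delta>"
    "\<And>p e. entry p = M \<Longrightarrow> entry e = (\<lambda>x y. if y = z then 1 else 0)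
      \<Longrightarrow> summable (\<lambda>n. norm ((p ^ N - \<delta> *\<^sub>R e) ^ n))"
proof -
  obtain N \<delta> \<beta> \<alpha> where N: "0 < N" "0 < \<delta>" and \<beta>: "0 < \<beta>" and \<alpha>: "0 \<le> \<alpha>" "\<alpha> < 1"
    and contr: "\<And>x F. finite F \<Longrightarrow>
      (\<Sum>y\<in>F. \<bar>mat_pow M N x y - (if y = z then \<delta> else 0)\<bar> * (1 + \<beta> * V y)) \<le> \<alpha> * (1 + \<beta> * V x)"
    by (rule minorized_power_contraction[of z]) (rule that; assumption)
  interpret W: weight "\<lambda>x. 1 + \<beta> * V x"
    using \<beta> pos by unfold_locales (simp add: add_pos_pos)
  obtain q' where q': "W.entry q' = (\<lambda>x y. mat_pow M N x y - (if y = z then \<delta> else 0))" "norm q' \<le> \<alpha>"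
    using contr by (rule W.entry_cases)
  show ?thesis
  proof (rule that[OF N])
    fix p e assume p: "entry p = M" and e: "entry e = (\<lambda>x y. if y = z then 1 else 0)"
    define q where "q = p ^ N - \<delta> *\<^sub>R e"
    \<comment> \<open>\<open>q\<close> and \<open>q'\<close> encode one matrix under two weights;
      their powers can therefore be compared entrywise.\<close>
    have "entry q = W.entry q'"
      by (intro ext) (simp add: q_def q' entry_power p e)
    then have qn: "entry (q ^ n) = W.entry (q' ^ n)" for n
      by (simp add: entry_power W.entry_power)
    have "norm (q ^ n) \<le> ((1 + \<beta>) / \<beta>) * \<alpha> ^ n" for n
    proof (rule norm_entry_le)
      fix x and F :: "'x set" assume F: "finite F"
      have "(\<Sum>y\<in>F. \<bar>entry (q ^ n) x y\<bar> * V y) \<le> (\<Sum>y\<in>F. \<bar>entry (q ^ n) x y\<bar> * ((1 + \<beta> * V y) / \<beta>))"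
      proof (intro sum_mono mult_left_mono)
        show "V y \<le> (1 + \<beta> * V y) / \<beta>" for y
          using \<beta> by (simp add: pos_le_divide_eq mult.commute)
      qed simp
      also have "\<dots> = (\<Sum>y\<in>F. \<bar>W.entry (q' ^ n) x y\<bar> * (1 + \<beta> * V y)) / \<beta>"
        by (simp add: sum_divide_distrib qn)
      also have "\<dots> \<le> (norm (q' ^ n) * (1 + \<beta> * V x)) / \<beta>"
        using \<beta> W.entry_row_bound[OF F] by (intro divide_right_mono) auto
      also have "\<dots> \<le> (\<alpha> ^ n * ((1 + \<beta>) * V x)) / \<beta>"
      proof (intro divide_right_mono mult_mono)
        show "norm (q' ^ n) \<le> \<alpha> ^ n"
          using norm_power_ineq[of q' n] power_mono[OF q'(2) norm_ge_zero, of n] by (rule order_trans)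
        show "1 + \<beta> * V x \<le> (1 + \<beta>) * V x" using V_ge_1[of x] by (simp add: algebra_simps)
      qed (use \<alpha> \<beta> W.pos[of x] in auto)
      finally show "(\<Sum>y\<in>F. \<bar>entry (q ^ n) x y\<bar> * V y) \<le> ((1 + \<beta>) / \<beta>) * \<alpha> ^ n * V x"
        by (simp add: algebra_simps)
    qed
    moreover have "summable (\<lambda>n. ((1 + \<beta>) / \<beta>) * \<alpha> ^ n)"
      using \<alpha> by (intro summable_mult summable_geometric) simp
    ultimately have "summable (\<lambda>n. norm (q ^ n))"
      by (intro summable_comparison_test[of "\<lambda>n. norm (q ^ n)" "\<lambda>n. ((1 + \<beta>) / \<beta>) * \<alpha> ^ n"])
         (auto simp only: real_norm_def abs_norm_cancel)
    then show "summable (\<lambda>n. norm ((p ^ N - \<delta> *\<^sub>R e) ^ n))" by (simp add: q_def)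
  qed
qed

end

section \<open>Stationary distributions\<close>

lemma infsum_ennreal_eq:
  fixes f :: "'x \<Rightarrow> real"
  assumes "f summable_on UNIV" "\<And>x. 0 \<le> f x"
  shows "(\<Sum>\<^sub>\<infinity>x. ennreal (f x)) = ennreal (\<Sum>\<^sub>\<infinity>x. f x)"
  using assms by (simp add: infsum_nonneg_is_SUPREMUM_ennreal nonneg_infsum_complete sum_ennreal)

lemma has_sum_diff:
  fixes f g :: "'x \<Rightarrow> real"
  assumes "(f has_sum a) A" "(g has_sum b) A"
  shows "((\<lambda>x. f x - g x) has_sum (a - b)) A"
  using has_sum_add[OF assms(1) has_sum_uminusI[OF assms(2)]] by simp

lemma has_sum_pmf: "(pmf d has_sum 1) UNIV"
proof -
  have "pmf d summable_on UNIV"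
    using abs_summable_equivalent[of "pmf d" UNIV] pmf_abs_summable[of d UNIV] by simp
  moreover have "infsum (pmf d) UNIV = 1"
    using infsetsum_infsum[OF pmf_abs_summable[of d UNIV]] infsetsum_pmf_eq_1[of d UNIV] by simp
  ultimately show ?thesis by (simp add: has_sum_iff)
qed

lemma pmf_of_has_sum:
  assumes "\<And>x. 0 \<le> f x" "(f has_sum 1) UNIV"
  obtains d where "pmf d = f"
proof -
  have "(\<lambda>x. norm (f x)) summable_on UNIV" using assms by (auto simp: has_sum_iff)
  then have s: "Infinite_Set_Sum.abs_summable_on f UNIV" using abs_summable_equivalent by blast
  have "(\<integral>\<^sup>+x. f x \<partial>count_space UNIV) = 1"
    using nn_integral_conv_infsetsum[OF s assms(1)] infsetsum_infsum[OF s] infsumI[OF assms(2)] by simp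
  from pmf_embed_pmf[OF assms(1) this] show ?thesis by (intro that[of "embed_pmf f"]) auto
qed

section \<open>Constant rows and single columns as kernels\<close>

context weight
begin

text \<open>A row of a product depends only on that row of the left factor, which permits arguing
  one row at a time.\<close>

lemma entry_row_cong:
  assumes "\<And>y. entry A x y = entry A' u y"
  shows "entry (A * B) x y = entry (A' * B) u y"
  using assms by (simp add: entry_mult mat_mult_def)

lemma entry_column_mult:
  assumes "entry e = (\<lambda>x y. if y = z then f x else 0)"
  shows "entry (A * e) x y = (if y = z then \<Sum>\<^sub>\<infinity>w. entry A x w * f w else 0)"
  by (simp add: entry_mult mat_mult_def assms)

lemma entry_column_has_sum:
  assumes "entry e = (\<lambda>x y. if y = z then f x else 0)"
  shows "((\<lambda>w. entry A x w * f w) has_sum entry (A * e) x z) UNIV"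
  using entry_mult_has_sum[of A x e z] by (simp add: assms)

text \<open>Hence \<open>e * A = A\<close> expresses that all rows of \<open>A\<close>
  agree.\<close>

lemma entry_constant_rows:
  assumes "entry e = (\<lambda>x y. if y = z then 1 else 0)"
  shows "entry (e * A) x y = entry A z y"
proof -
  have "entry (e * A) x y = entry (1 * A) z y"
    by (rule entry_row_cong) (auto simp: assms entry_one)
  then show ?thesis by simp
qed

end

text \<open>The triangle inequality bounds the absolute value of \<open>\<mu>\<close> by its image
  under \<open>M\<close>; both have the same total mass, so it is invariant too. Its sum with
  \<open>\<mu>\<close> is then a nonnegative invariant measure, positive at \<open>x0\<close> and
  zero at \<open>y0\<close>, which irreducibility forbids.\<close>

lemma (in finite_chain) invariant_constant_sign:
  assumes irr: "irreducible_chain M"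
    and \<mu>: "(\<lambda>x. \<bar>\<mu> x\<bar>) summable_on UNIV"
    and inv: "\<And>y. ((\<lambda>x. \<mu> x * M x y) has_sum \<mu> y) UNIV"
  shows "(\<forall>x. 0 \<le> \<mu> x) \<or> (\<forall>x. \<mu> x \<le> 0)"
proof (rule ccontr)
  assume "\<not> ?thesis"
  then obtain x0 y0 where x0: "\<mu> x0 > 0" and y0: "\<mu> y0 < 0" by (auto simp: not_le)
  interpret U: weight "\<lambda>_. 1" by unfold_locales simp
  have sum_le: "(\<Sum>y\<in>F. \<bar>\<mu> y\<bar>) \<le> (\<Sum>\<^sub>\<infinity>x. \<bar>\<mu> x\<bar>)" if "finite F" for F
    using that by (intro finite_sum_le_infsum[OF \<mu>]) auto
  obtain A where A: "U.entry A = (\<lambda>x y. \<mu> y)"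
    by (rule U.entry_cases[of "\<lambda>x y. \<mu> y" "\<Sum>\<^sub>\<infinity>x. \<bar>\<mu> x\<bar>"]) (auto simp: sum_le)
  obtain B where B: "U.entry B = (\<lambda>x y. \<bar>\<mu> y\<bar>)"
    by (rule U.entry_cases[of "\<lambda>x y. \<bar>\<mu> y\<bar>" "\<Sum>\<^sub>\<infinity>x. \<bar>\<mu> x\<bar>"]) (auto simp: sum_le)
  have "(\<Sum>y\<in>F. \<bar>M x y\<bar> * 1) \<le> 1 * 1" if "finite F" for x F
    using finite_sum_le_has_sum[OF mat_pow_row_sum[of 1 x] that] nonneg has_sum_row[of x "\<lambda>_. 1"]
      finite_sum_le_has_sum[OF has_sum_row[of x "\<lambda>_. 1"] that] by (simp add: mat_vec_finite support_sum)
  then obtain p where p: "U.entry p = M" by (rule U.entry_cases)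
  \<comment> \<open>A column of ones, so that multiplying by \<open>J\<close> computes total
    mass.\<close>
  obtain J where J: "U.entry J = (\<lambda>x y. if y = x0 then 1 else 0)"
    by (rule U.entry_cases[of "\<lambda>x y. if y = x0 then 1 else 0" 1]) (auto simp: if_distrib[of abs] sum.delta cong: if_cong)
  have Ap: "A * p = A"
    by (rule U.entry_eqI, intro ext) (simp add: U.entry_mult mat_mult_def A p infsumI[OF inv])
  have pJ: "p * J = J"
  proof (rule U.entry_eqI, intro ext)
    fix x y
    have "(\<Sum>\<^sub>\<infinity>w. M x w) = 1"
      using infsumI[OF has_sum_row[of x "\<lambda>_. 1"]] by (simp add: mat_vec_finite support_sum)
    then show "U.entry (p * J) x y = U.entry J x y"
      by (simp add: U.entry_column_mult[OF J] J p)
  qed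
  let ?\<rho> = "\<lambda>y. U.entry (B * p) x0 y"
  have \<rho>: "\<bar>\<mu> y\<bar> \<le> ?\<rho> y" for y
  proof -
    have hs: "((\<lambda>x. \<bar>\<mu> x\<bar> * M x y) has_sum ?\<rho> y) UNIV"
      using U.entry_mult_has_sum[of B x0 p y] by (simp add: B p)
    have "norm (\<mu> y) \<le> ?\<rho> y"
      by (rule norm_has_sum_bound[OF _ inv]) (use hs in \<open>simp add: abs_mult nonneg\<close>)
    then show ?thesis by simp
  qed
  have "((\<lambda>y. ?\<rho> y - \<bar>\<mu> y\<bar>) has_sum 0) UNIV"
  proof -
    have 1: "(?\<rho> has_sum U.entry (B * p * J) x0 x0) UNIV"
      using U.entry_column_has_sum[OF J, of "B * p" x0] by simp
    have 2: "((\<lambda>y. \<bar>\<mu> y\<bar>) has_sum U.entry (B * J) x0 x0) UNIV"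
      using U.entry_column_has_sum[OF J, of B x0] by (simp add: B)
    show ?thesis
      using has_sum_diff[OF 1 2] by (simp add: mult.assoc pJ)
  qed
  then have \<rho>_eq: "?\<rho> y = \<bar>\<mu> y\<bar>" for y
    using nonneg_has_sum_le_0D[of "\<lambda>y. ?\<rho> y - \<bar>\<mu> y\<bar>" UNIV 0 y] \<rho> by simp
  have Bp: "B * p = B"
  proof (rule U.entry_eqI, intro ext)
    fix x y
    have "U.entry (B * p) x y = U.entry (B * p) x0 y" by (rule U.entry_row_cong) (simp add: B)
    then show "U.entry (B * p) x y = U.entry B x y" by (simp add: \<rho>_eq B)
  qed
  obtain n where n: "0 < mat_pow M n x0 y0" using irr by (auto simp: irreducible_chain_def)
  have "(A + B) * p ^ n = A + B"
  proof (induction n)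
    case (Suc n)
    have "(A + B) * p = A + B" by (simp add: distrib_right Ap Bp)
    then show ?case using Suc by (simp add: mult.assoc[symmetric])
  qed simp
  then have "((\<lambda>x. (\<mu> x + \<bar>\<mu> x\<bar>) * mat_pow M n x y0) has_sum \<mu> y0 + \<bar>\<mu> y0\<bar>) UNIV"
    using U.entry_mult_has_sum[of "A + B" x0 "p ^ n" y0] by (simp add: A B p U.entry_power)
  from finite_sum_le_has_sum[OF this, of "{x0}"]
  have "(\<mu> x0 + \<bar>\<mu> x0\<bar>) * mat_pow M n x0 y0 \<le> 0"
    using y0 by (simp add: mat_pow_nonneg)
  moreover have "0 < (\<mu> x0 + \<bar>\<mu> x0\<bar>) * mat_pow M n x0 y0" using x0 n by (intro mult_pos_pos) auto
  ultimately show False by simp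
qed

lemma (in finite_chain) entry_le_1: "M x y \<le> 1"
  using finite_sum_le_has_sum[OF has_sum_row[of x "\<lambda>_. 1"], of "{y}"] nonneg
  by (simp add: mat_vec_finite support_sum)

text \<open>The difference of two stationary distributions is invariant, so it has constant sign;
  its total mass is zero, hence it vanishes.\<close>

lemma (in finite_chain) stationary_unique:
  assumes irr: "irreducible_chain M" and d: "stationary_for M d" and d': "stationary_for M d'"
  shows "d = d'"
proof -
  let ?\<mu> = "\<lambda>x. pmf d x - pmf d' x"
  have inv: "((\<lambda>x. pmf d x * M x y) has_sum pmf d y) UNIV" if "stationary_for M d" for d y
  proof -
    have "(\<lambda>x. pmf d x * M x y) summable_on UNIV"
      by (rule summable_on_comparison_test[OF has_sum_imp_summable[OF has_sum_pmf[of d]]])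
         (auto simp: nonneg entry_le_1 mult_left_le)
    then show ?thesis using that by (simp add: has_sum_iff stationary_for_def)
  qed
  have 0: "(?\<mu> has_sum 0) UNIV"
    using has_sum_diff[OF has_sum_pmf[of d] has_sum_pmf[of d']] by simp
  have "(\<forall>x. 0 \<le> ?\<mu> x) \<or> (\<forall>x. ?\<mu> x \<le> 0)"
  proof (rule invariant_constant_sign[OF irr])
    show "(\<lambda>x. \<bar>?\<mu> x\<bar>) summable_on UNIV"
      using iffD1[OF summable_on_iff_abs_summable_on_real has_sum_imp_summable[OF 0]] by simp
    show "((\<lambda>x. ?\<mu> x * M x y) has_sum ?\<mu> y) UNIV" for y
      using has_sum_diff[OF inv[OF d, of y] inv[OF d', of y]] by (simp add: left_diff_distrib)
  qed
  then have "?\<mu> x = 0" for x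
  proof
    assume "\<forall>x. 0 \<le> ?\<mu> x"
    then show ?thesis using nonneg_has_sum_le_0D[OF 0, of x] by auto
  next
    assume *: "\<forall>x. ?\<mu> x \<le> 0"
    have "((\<lambda>x. - ?\<mu> x) has_sum 0) UNIV" using has_sum_uminusI[OF 0] by simp
    from nonneg_has_sum_le_0D[OF this, of x] * show ?thesis by auto
  qed
  then show ?thesis by (intro pmf_eqI) simp
qed

text \<open>The three equations give invariance, total mass \<open>1\<close> and equal rows;
  constancy of sign turns the common row into a distribution. The lemma serves the reference and the
  perturbed chain.\<close>

lemma (in weighted_chain) stationary_of_projection:
  assumes p: "entry p = M" and e: "entry e = (\<lambda>x y. if y = z then 1 else 0)"
    and \<nu>p: "\<nu> * p = \<nu>" and \<nu>e: "\<nu> * e = e" and e\<nu>: "e * \<nu> = \<nu>"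
  shows "\<exists>!d. stationary_for M d" and "entry \<nu> = stat_matrix M"
proof -
  let ?\<mu> = "\<lambda>y. entry \<nu> z y"
  have const: "entry \<nu> x y = ?\<mu> y" for x y
    using entry_constant_rows[OF e, of \<nu> x y] by (simp add: e\<nu>)
  have inv: "((\<lambda>x. ?\<mu> x * M x y) has_sum ?\<mu> y) UNIV" for y
    using entry_mult_has_sum[of \<nu> z p y] by (simp add: \<nu>p p)
  have 1: "(?\<mu> has_sum 1) UNIV"
    using entry_column_has_sum[OF e, of \<nu> z] by (simp add: \<nu>e e)
  have "(\<lambda>x. \<bar>?\<mu> x\<bar>) summable_on UNIV"
    using iffD1[OF summable_on_iff_abs_summable_on_real has_sum_imp_summable[OF 1]] by simp
  from invariant_constant_sign[OF irreducible this inv]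
  have "0 \<le> ?\<mu> x" for x
  proof
    assume "\<forall>x. ?\<mu> x \<le> 0"
    then have "(1::real) \<le> 0" by (intro has_sum_mono[OF 1 has_sum_0_simp]) auto
    then show ?thesis by simp
  qed auto
  from pmf_of_has_sum[OF this 1] obtain d where d: "pmf d = ?\<mu>" by blast
  have st: "stationary_for M d"
    using infsumI[OF inv] by (simp add: stationary_for_def d)
  then show "\<exists>!d. stationary_for M d"
    using stationary_unique[OF irreducible] by blast
  have sd: "stat_dist M = d"
    unfolding stat_dist_def
  proof (rule the_equality)
    show "stationary_for M d" by (rule st)
    show "d' = d" if "stationary_for M d'" for d' by (rule stationary_unique[OF irreducible that st])
  qed
  show "entry \<nu> = stat_matrix M"
    by (intro ext) (simp only: stat_matrix_def sd d, rule const)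
qed

text \<open>The drift bounds the norm of the transition matrix, and the contraction estimate
  supplies the remainder \<open>p ^ N - \<delta> *\<^sub>R e\<close> for the algebraic
  construction.\<close>

lemma (in drift_chain) ergodic_projection:
  obtains p e \<pi> where "entry p = M" "entry e = (\<lambda>x y. if y = z then 1 else 0)"
    "\<pi> * p = \<pi>" "p * \<pi> = \<pi>" "\<pi> * \<pi> = \<pi>" "\<pi> * e = e" "e * \<pi> = \<pi>" "p * e = e"
    "summable (\<lambda>k. norm ((p - \<pi>) ^ k))"
proof -
  have "(\<Sum>y\<in>F. \<bar>M x y\<bar> * V y) \<le> (\<epsilon> + b) * V x" if "finite F" for x F
  proof -
    have "(\<Sum>y\<in>F. \<bar>M x y\<bar> * V y) \<le> mat_vec M V x"
      using finite_sum_le_has_sum[OF has_sum_row that, of x V] nonneg pos by (simp add: less_imp_le)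
    also have "\<dots> \<le> \<epsilon> * V x + b * 1" using drift_le_b by simp
    also have "\<dots> \<le> \<epsilon> * V x + b * V x" using V_ge_1 b by (intro add_left_mono mult_left_mono) auto
    finally show ?thesis by (simp add: algebra_simps)
  qed
  then obtain p where p: "entry p = M" by (rule entry_cases)
  have "(\<Sum>y\<in>F. \<bar>if y = z then 1 else 0\<bar> * V y) \<le> V z * V x" if "finite F" for x F
  proof -
    have "(\<Sum>y\<in>F. \<bar>if y = z then 1 else 0\<bar> * V y) = (\<Sum>y\<in>F. if y = z then V z else 0)"
      by (intro sum.cong) auto
    also have "\<dots> \<le> V z * 1" using that pos[of z] by simp
    also have "\<dots> \<le> V z * V x" using V_ge_1 pos[of z] by (intro mult_left_mono) auto
    finally show ?thesis .
  qed
  then obtain e where e: "entry e = (\<lambda>x y. if y = z then 1 else 0)"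
    by (rule entry_cases[of "\<lambda>x y. if y = z then 1 else 0" "V z"])
  have pe: "p * e = e"
  proof (rule entry_eqI, intro ext)
    fix x y
    have "(\<Sum>\<^sub>\<infinity>w. M x w) = 1"
      using infsumI[OF has_sum_row[of x "\<lambda>_. 1"]] by (simp add: mat_vec_finite support_sum)
    then show "entry (p * e) x y = entry e x y"
      by (simp add: entry_column_mult[OF e] e p)
  qed
  have ee: "e * e = e"
    by (rule entry_eqI, intro ext) (simp add: entry_constant_rows[OF e], simp add: e)
  obtain N \<delta> where N: "0 < N" "0 < \<delta>"
    and sum: "\<And>p e. entry p = M \<Longrightarrow> entry e = (\<lambda>x y. if y = z then 1 else 0)
      \<Longrightarrow> summable (\<lambda>n. norm ((p ^ N - \<delta> *\<^sub>R e) ^ n))"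
    by (rule minorized_power_summable[of z]) (rule that; assumption)
  have "p ^ N = (p ^ N - \<delta> *\<^sub>R e) + \<delta> *\<^sub>R e" "\<delta> \<noteq> 0" using N by auto
  from this(1) N(1) this(2) pe ee sum[OF p e] show ?thesis
    by (rule minorized_power_projection) (rule that[OF p e _ _ _ _ _ pe]; assumption)
qed

section \<open>The average cost bound\<close>

lemma finite_chain_policy_matrix:
  fixes P :: "'x \<Rightarrow> 'a::finite \<Rightarrow> 'x pmf"
  assumes "\<And>x a. finite {y. pmf (P x a) y > 0}"
  shows "finite_chain (policy_matrix P \<pi>)"
proof
  fix x y
  let ?M = "policy_matrix P \<pi>"
  show "0 \<le> ?M x y"
    by (simp add: policy_matrix_def sum_nonneg)
  let ?S = "\<Union>a. set_pmf (P x a)"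
  have S: "finite ?S"
    using assms[of x] by (simp add: pmf_positive_iff)
  have sub: "{y. ?M x y \<noteq> 0} \<subseteq> ?S"
  proof
    fix y assume y: "y \<in> {y. ?M x y \<noteq> 0}"
    show "y \<in> ?S"
    proof (rule ccontr)
      assume "y \<notin> ?S"
      then have "pmf (P x a) y = 0" for a by (simp add: set_pmf_iff)
      then show False using y by (simp add: policy_matrix_def)
    qed
  qed
  then show "finite {y. ?M x y \<noteq> 0}" using S by (rule finite_subset)
  have "(\<Sum>y | ?M x y \<noteq> 0. ?M x y) = (\<Sum>y\<in>?S. ?M x y)"
    using S sub by (intro sum.mono_neutral_left) auto
  also have "\<dots> = (\<Sum>a\<in>UNIV. pmf (\<pi> x) a * (\<Sum>y\<in>?S. pmf (P x a) y))"
    unfolding policy_matrix_def sum_distrib_left by (rule sum.swap)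
  also have "\<dots> = (\<Sum>a\<in>UNIV. pmf (\<pi> x) a * 1)"
    using S by (intro sum.cong refl arg_cong2[of _ _ _ _ "(*)"] sum_pmf_eq_1) auto
  also have "\<dots> = 1" using sum_pmf_eq_1[of UNIV "\<pi> x"] by simp
  finally show "(\<Sum>y | ?M x y \<noteq> 0. ?M x y) = 1" .
qed

section \<open>Real bounds from the extended-valued norms\<close>

context weight
begin

lemma mat_norm_row_bound:
  assumes fin: "mat_norm V K < \<top>" and F: "finite F"
  shows "(\<Sum>y\<in>F. \<bar>K x y\<bar> * V y) \<le> enn2real (mat_norm V K) * V x"
proof -
  let ?s = "\<Sum>y\<in>F. \<bar>K x y\<bar> * V y"
  have "ennreal ?s = (\<Sum>y\<in>F. ennreal (\<bar>K x y\<bar> * V y))"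
    using pos by (intro sum_ennreal[symmetric]) (simp add: less_imp_le)
  also have "\<dots> = (\<Sum>\<^sub>\<infinity>y\<in>F. ennreal (\<bar>K x y\<bar> * V y))"
    using F by simp
  also have "\<dots> \<le> (\<Sum>\<^sub>\<infinity>y. ennreal (\<bar>K x y\<bar> * V y))"
    by (intro infsum_mono_neutral nonneg_summable_on_complete) auto
  finally have "ennreal (1 / V x) * ennreal ?s \<le> ennreal (1 / V x) * (\<Sum>\<^sub>\<infinity>y. ennreal (\<bar>K x y\<bar> * V y))"
    by (intro mult_left_mono) auto
  also have "\<dots> \<le> mat_norm V K"
    unfolding mat_norm_def by (rule SUP_upper) simp
  also have "\<dots> = ennreal (enn2real (mat_norm V K))"
    using fin by simp
  finally have "ennreal (1 / V x * ?s) \<le> ennreal (enn2real (mat_norm V K))"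
    using pos[of x] by (simp add: ennreal_mult'[symmetric])
  then have "1 / V x * ?s \<le> enn2real (mat_norm V K)"
    by (simp add: ennreal_le_iff)
  then show ?thesis
    using pos[of x] by (simp add: pos_divide_le_eq)
qed

text \<open>Any bound by a multiple of \<open>V\<close> makes the supremum finite, so
  \<open>enn2real\<close> loses nothing.\<close>

lemma vec_norm_real:
  assumes "\<And>x. \<bar>f x\<bar> \<le> c * V x"
  shows "ennreal (enn2real (vec_norm V f)) = vec_norm V f"
    and "\<bar>f x\<bar> \<le> enn2real (vec_norm V f) * V x"
proof -
  have "vec_norm V f \<le> ennreal c"
    unfolding vec_norm_def using assms pos by (intro SUP_least ennreal_leI) (simp add: pos_divide_le_eq)
  then show 1: "ennreal (enn2real (vec_norm V f)) = vec_norm V f"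
    by (intro ennreal_enn2real) (rule le_less_trans, assumption, simp)
  have "ennreal (\<bar>f x\<bar> / V x) \<le> vec_norm V f"
    unfolding vec_norm_def by (rule SUP_upper) simp
  then have "ennreal (\<bar>f x\<bar> / V x) \<le> ennreal (enn2real (vec_norm V f))" by (simp only: 1)
  then have "\<bar>f x\<bar> / V x \<le> enn2real (vec_norm V f)"
    by (simp add: ennreal_le_iff)
  then show "\<bar>f x\<bar> \<le> enn2real (vec_norm V f) * V x"
    using pos[of x] by (simp add: pos_divide_le_eq)
qed

text \<open>The factor \<open>V z\<close> comes from placing the function in column
  \<open>z\<close>; it cancels when entries of that column are read off.\<close>

lemma column_cases:
  assumes "\<And>x. \<bar>f x\<bar> \<le> c * V x"
  obtains A where "entry A = (\<lambda>x y. if y = z then f x else 0)" "norm A \<le> c * V z"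
proof -
  have "(\<Sum>y\<in>F. \<bar>if y = z then f x else 0\<bar> * V y) \<le> (c * V z) * V x" if "finite F" for x F
  proof -
    have "(\<Sum>y\<in>F. \<bar>if y = z then f x else 0\<bar> * V y) = (\<Sum>y\<in>F. if y = z then \<bar>f x\<bar> * V z else 0)"
      by (intro sum.cong) auto
    also have "\<dots> \<le> \<bar>f x\<bar> * V z" using that pos[of z] by simp
    also have "\<dots> \<le> (c * V x) * V z" using assms pos[of z] by (intro mult_right_mono) auto
    finally show ?thesis by (simp add: algebra_simps)
  qed
  then obtain A where "entry A = (\<lambda>x y. if y = z then f x else 0)" "norm A \<le> c * V z"
    by (rule entry_cases)
  then show ?thesis by (rule that)
qed

end

text \<open>Entries are bounded linear functionals, so the norm-convergent series for
  \<open>Z\<close> has the entrywise sums of \<open>fund_matrix\<close> as its entries.\<close>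

lemma (in drift_chain) fundamental_kernel:
  obtains p e \<pi> Z where "entry p = M" "entry e = (\<lambda>x y. if y = z then 1 else 0)"
    "\<pi> * p = \<pi>" "\<pi> * \<pi> = \<pi>" "\<pi> * e = e" "e * \<pi> = \<pi>" "p * e = e"
    "entry \<pi> = stat_matrix M" "entry Z = fund_matrix M"
    "(1 - (p - \<pi>)) * Z = 1" "Z * (1 - (p - \<pi>)) = 1"
    "\<exists>!d. stationary_for M d"
    "\<And>x y. summable (\<lambda>k. mat_pow (mat_diff M (stat_matrix M)) k x y)"
proof -
  obtain p e \<pi> where p: "entry p = M" and e: "entry e = (\<lambda>x y. if y = z then 1 else 0)"
    and *: "\<pi> * p = \<pi>" "\<pi> * \<pi> = \<pi>" "\<pi> * e = e" "e * \<pi> = \<pi>" "p * e = e"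
    and s: "summable (\<lambda>k. norm ((p - \<pi>) ^ k))"
    by (rule ergodic_projection[of z]) (rule that; assumption)
  note st = stationary_of_projection[OF p e *(1,3,4)]
  define Z where "Z = (\<Sum>k. (p - \<pi>) ^ k)"
  have "entry (p - \<pi>) = mat_diff M (stat_matrix M)"
    by (intro ext) (simp add: mat_diff_def p st)
  then have pow: "entry ((p - \<pi>) ^ k) = mat_pow (mat_diff M (stat_matrix M)) k" for k
    by (simp add: entry_power)
  have s': "summable (\<lambda>k. (p - \<pi>) ^ k)" using s by (rule summable_norm_cancel)
  have sum: "summable (\<lambda>k. mat_pow (mat_diff M (stat_matrix M)) k x y)" for x y
    using bounded_linear.summable[OF bounded_linear_entry s', of x y] by (simp only: pow)
  have Z: "entry Z = fund_matrix M"
    using bounded_linear.suminf[OF bounded_linear_entry s'] by (intro ext) (simp only: Z_def fund_matrix_def pow)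
  show ?thesis
    by (rule that[OF p e * st(2) Z geometric_resolvent[OF s, folded Z_def] st(1) sum])
qed

text \<open>The row of \<open>M' - M\<close> is singled out because \<open>M'\<close> is not known to be \<open>V\<close>-bounded: that follows
  only now, from \<open>M' - M = m (1 - p + \<pi>)\<close> with \<open>m = (M' - M) Z\<close>.\<close>

lemma (in drift_chain) perturbation_kernel:
  assumes M': "weighted_chain M' V"
    and p: "entry p = M" and e: "entry e = (\<lambda>x y. if y = z then 1 else 0)"
    and Z: "entry Z = fund_matrix M" and ZT: "Z * T = 1" and Te: "T * e = e"
    and m: "entry m = mat_mult (mat_diff M' M) (fund_matrix M)"
  shows "entry (p + m * T) = M'" and "m * e = 0"
proof -
  interpret M': weighted_chain M' V by (rule M')
  define \<Delta> where "\<Delta> = mat_diff M' M"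
  \<comment> \<open>A single row of the difference is finitely supported, so the matrix with this
    row and zeros elsewhere lies in the algebra, where associativity is available.\<close>
  have "\<exists>k. entry k x = \<Delta> x" for x
  proof -
    let ?S = "{y. M x y \<noteq> 0} \<union> {y. M' x y \<noteq> 0}"
    let ?K = "\<lambda>u. if u = x then \<Delta> x else (\<lambda>_. 0)"
    have S: "finite ?S" using finite_support M'.finite_support by simp
    have \<Delta>0: "\<Delta> x y = 0" if "y \<notin> ?S" for y using that by (simp add: \<Delta>_def mat_diff_def)
    have "(\<Sum>y\<in>F. \<bar>?K u y\<bar> * V y) \<le> (\<Sum>y\<in>?S. \<bar>\<Delta> x y\<bar> * V y) * V u" if F: "finite F" for u F
    proof -
      have "(\<Sum>y\<in>F. \<bar>?K u y\<bar> * V y) \<le> (\<Sum>y\<in>F. \<bar>\<Delta> x y\<bar> * V y)"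
        using pos by (intro sum_mono) (auto simp: less_imp_le)
      also have "\<dots> \<le> (\<Sum>y\<in>F \<union> ?S. \<bar>\<Delta> x y\<bar> * V y)"
        using F S pos by (intro sum_mono2) (auto simp: less_imp_le)
      also have "\<dots> = (\<Sum>y\<in>?S. \<bar>\<Delta> x y\<bar> * V y) * 1"
        unfolding mult_1_right using F S \<Delta>0 by (intro sum.mono_neutral_right) auto
      also have "\<dots> \<le> (\<Sum>y\<in>?S. \<bar>\<Delta> x y\<bar> * V y) * V u"
        using pos V_ge_1 by (intro mult_left_mono sum_nonneg) (auto simp: less_imp_le)
      finally show ?thesis .
    qed
    then obtain k where "entry k = ?K" by (rule entry_cases)
    then show ?thesis by (intro exI[of _ k]) simp
  qed
  then have "\<exists>k. \<forall>x. entry (k x) x = \<Delta> x" by (intro choice allI)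
  then obtain k where k: "\<And>x. entry (k x) x = \<Delta> x" by blast
  have kZ: "entry (k x * Z) x = entry m x" for x
    by (intro ext) (simp add: entry_mult m Z k mat_mult_def \<Delta>_def)
  have \<Delta>: "entry (m * T) x y = \<Delta> x y" for x y
  proof -
    have "entry (m * T) x y = entry (k x * Z * T) x y"
      by (rule entry_row_cong) (simp add: kZ)
    then show ?thesis by (simp add: mult.assoc ZT k)
  qed
  then show "entry (p + m * T) = M'"
    by (intro ext) (simp add: p \<Delta>_def mat_diff_def)
  have "Z * e = e"
    using ZT Te by (metis mult.assoc mult_1_left)
  show "m * e = 0"
  proof (rule entry_eqI, intro ext)
    fix x y
    \<comment> \<open>Rows of both transition matrices sum to \<open>1\<close>.\<close>
    have "((\<lambda>w. \<Delta> x w) has_sum (1 - 1)) UNIV"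
      using has_sum_diff[OF M'.has_sum_row[of x "\<lambda>_. 1"] has_sum_row[of x "\<lambda>_. 1"]]
      by (simp add: mat_vec_finite M'.mat_vec_finite support_sum M'.support_sum \<Delta>_def mat_diff_def)
    then have \<Delta>_sum: "(\<Sum>\<^sub>\<infinity>w. \<Delta> x w) = 0" by (simp add: infsumI)
    have "entry (m * e) x y = entry (k x * Z * e) x y"
      by (rule entry_row_cong) (simp add: kZ)
    also have "\<dots> = entry (k x * e) x y" by (simp add: mult.assoc \<open>Z * e = e\<close>)
    also have "\<dots> = 0" by (simp add: entry_column_mult[OF e] k \<Delta>_sum)
    finally show "entry (m * e) x y = entry 0 x y" by simp
  qed
qed

lemma (in drift_chain) average_cost_bound:
  assumes M': "weighted_chain M' V" and g: "\<And>x. \<bar>g x\<bar> \<le> V x"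
    and dev: "policy_deviation V M' M < 1"
  shows "(\<exists>!d. stationary_for M d) \<and> dist_summable (stat_dist M) g
       \<and> (\<exists>!d. stationary_for M' d) \<and> dist_summable (stat_dist M') g
       \<and> (\<forall>x y. summable (\<lambda>k. mat_pow (mat_diff M (stat_matrix M)) k x y))
       \<and> (\<forall>x. (\<lambda>y. fund_matrix M x y * centred_cost M g y) summable_on UNIV)
       \<and> dist_summable (stat_dist M) (poisson_residual M' M g)
       \<and> N2 V M' M g < \<infinity>
       \<and> avg_cost M' g - avg_cost M g \<le> N1 M' M g + enn2real (N2 V M' M g)"
proof -
  interpret M': weighted_chain M' V by (rule M')
  \<comment> \<open>An arbitrary state, whose column holds the functions \<open>g\<close> and
    \<open>f\<close>.\<close>
  fix z :: 'x
  obtain p e \<pi> Z where p: "entry p = M" and e: "entry e = (\<lambda>x y. if y = z then 1 else 0)"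
    and \<pi>: "\<pi> * p = \<pi>" "\<pi> * \<pi> = \<pi>" "\<pi> * e = e" "e * \<pi> = \<pi>" and pe: "p * e = e"
    and \<pi>_entry: "entry \<pi> = stat_matrix M" and Z: "entry Z = fund_matrix M"
    and TZ: "(1 - (p - \<pi>)) * Z = 1" and ZT: "Z * (1 - (p - \<pi>)) = 1"
    and ex: "\<exists>!d. stationary_for M d"
    and sum: "\<And>x y. summable (\<lambda>k. mat_pow (mat_diff M (stat_matrix M)) k x y)"
    by (rule fundamental_kernel[of z]) (rule that; assumption)
  define D where "D = enn2real (policy_deviation V M' M)"
  have dev_lt: "policy_deviation V M' M < \<top>" using dev by (rule less_trans) simp
  then have D_eq: "policy_deviation V M' M = ennreal D" by (simp add: D_def)
  have D: "0 \<le> D" "D < 1"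
    using dev unfolding D_eq by (simp_all add: D_def)
  have "(\<Sum>y\<in>F. \<bar>mat_mult (mat_diff M' M) (fund_matrix M) x y\<bar> * V y) \<le> D * V x" if "finite F" for x F
    unfolding D_def policy_deviation_def
    by (rule mat_norm_row_bound[OF dev_lt[unfolded policy_deviation_def] that])
  then obtain m where m: "entry m = mat_mult (mat_diff M' M) (fund_matrix M)" and mD: "norm m \<le> D"
    by (rule entry_cases)
  have m1: "norm m < 1" using mD D by simp
  define T where "T = 1 - (p - \<pi>)"
  have Te: "T * e = e" by (simp add: T_def algebra_simps pe \<pi>)
  note pert = perturbation_kernel[OF M' p e Z ZT[folded T_def] Te m]
  obtain \<nu> r where \<nu>: "\<nu> * (p + m * T) = \<nu>" "\<nu> * e = e" "e * \<nu> = \<nu>"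
    and \<nu>_eq: "\<nu> = \<pi> + \<pi> * m + \<pi> * r" and r: "norm r \<le> (norm m)\<^sup>2 / (1 - norm m)"
    by (rule perturbed_projection[OF \<pi> m1 pert(2), folded T_def]) (rule that; assumption)
  note st' = M'.stationary_of_projection[OF pert(1) e \<nu>]

  have "\<bar>g x\<bar> \<le> 1 * V x" for x using g[of x] by simp
  then obtain G where G: "entry G = (\<lambda>x y. if y = z then g x else 0)" by (rule column_cases)
  have G_sum: "((\<lambda>w. pmf (stat_dist M) w * g w) has_sum entry (\<pi> * G) x z) UNIV"
    "((\<lambda>w. pmf (stat_dist M') w * g w) has_sum entry (\<nu> * G) x z) UNIV" for x
    using entry_column_has_sum[OF G, of \<pi> x] entry_column_has_sum[OF G, of \<nu> x]
    by (simp_all add: \<pi>_entry st' stat_matrix_def)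
  have g_summable: "dist_summable (stat_dist M) g" "dist_summable (stat_dist M') g"
    using G_sum by (auto simp: dist_summable_def intro: has_sum_imp_summable)
  define \<eta> where "\<eta> = avg_cost M g"
  have \<pi>G: "entry (\<pi> * G) x z = \<eta>" for x
    unfolding \<eta>_def avg_cost_def dist_sum_def by (rule infsumI[OF G_sum(1), symmetric])
  have \<nu>G: "avg_cost M' g = entry (\<nu> * G) z z"
    unfolding avg_cost_def dist_sum_def by (rule infsumI[OF G_sum(2)])

  define f where "f = centred_cost M g"
  have f: "f x = g x - \<eta>" for x by (simp add: f_def centred_cost_def \<eta>_def)
  have f_le: "\<bar>f x\<bar> \<le> (1 + \<bar>\<eta>\<bar>) * V x" for x
  proof -
    have "\<bar>\<eta>\<bar> * 1 \<le> \<bar>\<eta>\<bar> * V x" using V_ge_1 by (intro mult_left_mono) auto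
    then show ?thesis using g[of x] by (simp add: f algebra_simps)
  qed
  define c where "c = enn2real (vec_norm V f)"
  have c_eq: "vec_norm V f = ennreal c" and fc: "\<And>x. \<bar>f x\<bar> \<le> c * V x" and c0: "0 \<le> c"
    unfolding c_def using vec_norm_real[of f "1 + \<bar>\<eta>\<bar>"] f_le by auto
  obtain A where A: "entry A = (\<lambda>x y. if y = z then f x else 0)" and A_norm: "norm A \<le> c * V z"
    using fc by (rule column_cases)
  have AG: "A = G - \<eta> *\<^sub>R e"
    by (rule entry_eqI, intro ext) (simp add: A G e f)
  \<comment> \<open>Centring makes the order zero term of the expansion vanish.\<close>
  have \<pi>A: "entry (\<pi> * A) x z = 0" for x
    by (simp add: AG right_diff_distrib \<pi>G \<pi> e)
  have \<nu>A: "entry (\<nu> * A) z z = avg_cost M' g - \<eta>"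
    by (simp add: AG right_diff_distrib \<nu>G \<nu> e)

  have f_summable: "(\<lambda>y. fund_matrix M x y * f y) summable_on UNIV" for x
    using has_sum_imp_summable[OF entry_column_has_sum[OF A, of Z x]] by (simp add: Z)
  have h: "poisson_sol M g x = entry (Z * A) x z" for x
    using infsumI[OF entry_column_has_sum[OF A, of Z x]]
    by (simp add: poisson_sol_def mat_vec_def Z f_def)
  have \<pi>Z: "\<pi> * Z = \<pi>"
  proof -
    have "\<pi> * T = \<pi>" by (simp add: T_def algebra_simps \<pi>)
    then show ?thesis using TZ[folded T_def] by (metis mult.assoc mult_1_right)
  qed
  have residual: "poisson_residual M' M g x = entry (m * A) x z" for x
  proof -
    \<comment> \<open>Substituting \<open>p = 1 + \<pi> - T\<close> and using that \<open>Z\<close>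
      inverts \<open>T\<close> reduces the Poisson residual to \<open>m * A\<close>, up to the
      vanishing term \<open>\<pi> * A\<close>.\<close>
    have "(p + m * T) * (Z * A) = (p + m * T) * Z * A" by (simp only: mult.assoc)
    also have "(p + m * T) * Z = (1 + \<pi> - T) * Z + m * (T * Z)"
      by (simp add: T_def algebra_simps)
    also have "\<dots> = Z + \<pi> - 1 + m"
      by (simp add: TZ[folded T_def] left_diff_distrib distrib_right \<pi>Z)
    finally have "A + (p + m * T) * (Z * A) - Z * A = m * A + \<pi> * A"
      by (simp add: left_diff_distrib distrib_right)
    moreover have "mat_vec M' (poisson_sol M g) x = entry ((p + m * T) * (Z * A)) x z"
      using infsumI[OF entry_mult_has_sum[of "p + m * T" x "Z * A" z]]
      by (simp only: mat_vec_def h pert(1))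
    ultimately have "poisson_residual M' M g x = entry (m * A + \<pi> * A) x z"
      by (metis (no_types, lifting) A \<eta>_def entry_add entry_diff f h poisson_residual_def)
    then show ?thesis by (simp add: \<pi>A)
  qed
  have residual_sum: "((\<lambda>w. pmf (stat_dist M) w * poisson_residual M' M g w) has_sum entry (\<pi> * (m * A)) z z) UNIV"
    using entry_mult_has_sum[of \<pi> z "m * A" z] by (simp add: \<pi>_entry stat_matrix_def residual)
  have N1_eq: "N1 M' M g = entry (\<pi> * m * A) z z"
    using infsumI[OF residual_sum] by (simp add: N1_def dist_sum_def mult.assoc)

  define dV where "dV = (\<Sum>\<^sub>\<infinity>x. pmf (stat_dist M) x * V x)"
  have dV_summable: "(\<lambda>x. pmf (stat_dist M) x * V x) summable_on UNIV"
    using entry_weight_summable(1)[of \<pi> z] by (simp add: \<pi>_entry stat_matrix_def)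
  have dV_eq: "(\<Sum>\<^sub>\<infinity>x. ennreal (pmf (stat_dist M) x * V x)) = ennreal dV"
    unfolding dV_def using dV_summable pos by (intro infsum_ennreal_eq) (auto simp: less_imp_le)
  have dV0: "0 \<le> dV" unfolding dV_def using pos by (intro infsum_nonneg) (simp add: less_imp_le)
  have "1 - policy_deviation V M' M = ennreal (1 - D)"
    using ennreal_minus[OF D(1), of 1] by (simp add: D_eq)
  then have "N2 V M' M g = ennreal (D\<^sup>2 / (1 - D)) * ennreal c * ennreal dV"
    using D unfolding N2_def f_def[symmetric] c_eq dV_eq
    by (simp add: D_eq ennreal_power divide_ennreal)
  then have N2_eq: "N2 V M' M g = ennreal (D\<^sup>2 / (1 - D) * c * dV)"
    using D c0 dV0 by (simp add: ennreal_mult[symmetric])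

  have "entry (\<pi> * (r * A)) z z \<le> D\<^sup>2 / (1 - D) * c * dV"
  proof -
    \<comment> \<open>The quotient of the square of \<open>t\<close> by \<open>1 - t\<close>
      increases on \<open>[0, 1)\<close>, so \<open>norm m\<close> may be replaced by
      \<open>D\<close>.\<close>
    have r_le: "norm r \<le> D\<^sup>2 / (1 - D)"
      using r mD D frac_le[of "D\<^sup>2" "(norm m)\<^sup>2" "1 - D" "1 - norm m"] power_mono[OF mD norm_ge_zero, of 2] by simp
    have rA: "entry (r * A) w z \<le> D\<^sup>2 / (1 - D) * c * V w" for w
    proof -
      have "norm (r * A) \<le> D\<^sup>2 / (1 - D) * (c * V z)"
        using r_le A_norm D by (intro order_trans[OF norm_mult_ineq mult_mono]) auto
      then have "norm (r * A) * V w \<le> D\<^sup>2 / (1 - D) * (c * V z) * V w"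
        using pos[of w] by (intro mult_right_mono) auto
      \<comment> \<open>The weight of the entry in column \<open>z\<close> cancels the factor
        \<open>V z\<close> in the norm bound of \<open>A\<close>.\<close>
      with abs_entry_le[of "r * A" w z]
      have "\<bar>entry (r * A) w z\<bar> * V z \<le> (D\<^sup>2 / (1 - D) * c * V w) * V z"
        by (simp add: algebra_simps)
      then have "\<bar>entry (r * A) w z\<bar> \<le> D\<^sup>2 / (1 - D) * c * V w"
        using pos[of z] by (simp only: mult_le_cancel_right_pos)
      then show ?thesis by linarith
    qed
    have "((\<lambda>w. pmf (stat_dist M) w * entry (r * A) w z) has_sum entry (\<pi> * (r * A)) z z) UNIV"
      using entry_mult_has_sum[of \<pi> z "r * A" z] by (simp add: \<pi>_entry stat_matrix_def)
    moreover have "((\<lambda>w. D\<^sup>2 / (1 - D) * c * (pmf (stat_dist M) w * V w)) has_sum D\<^sup>2 / (1 - D) * c * dV) UNIV"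
      unfolding dV_def by (intro has_sum_cmult_right has_sum_infsum dV_summable)
    ultimately show ?thesis
    proof (rule has_sum_mono)
      show "pmf (stat_dist M) w * entry (r * A) w z \<le> D\<^sup>2 / (1 - D) * c * (pmf (stat_dist M) w * V w)" for w
        using mult_left_mono[OF rA pmf_nonneg] by (simp add: algebra_simps)
    qed
  qed
  moreover have "avg_cost M' g - avg_cost M g = N1 M' M g + entry (\<pi> * (r * A)) z z"
    using \<nu>A unfolding N1_eq by (simp add: \<nu>_eq distrib_right \<pi>A \<eta>_def mult.assoc)
  ultimately have "avg_cost M' g - avg_cost M g \<le> N1 M' M g + enn2real (N2 V M' M g)"
    using D c0 dV0 by (simp add: N2_eq)
  moreover have "N2 V M' M g < \<infinity>" by (simp add: N2_eq)
  moreover have "dist_summable (stat_dist M) (poisson_residual M' M g)"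
    unfolding dist_summable_def by (rule has_sum_imp_summable[OF residual_sum])
  ultimately show ?thesis
    using ex st'(1) sum g_summable f_summable by (simp add: f_def)
qed

text \<open>The uniqueness and summability conjuncts ensure that the stationary distributions and
  the series they mention are genuine values rather than defaults; finiteness of \<open>N2\<close>
  makes \<open>enn2real\<close> faithful.\<close>

theorem theorem1:
  fixes P :: "'x::countable \<Rightarrow> 'a::finite \<Rightarrow> 'x pmf"
    and g :: "'x \<Rightarrow> real"
    and \<Theta> :: "(real ^ 'm) set"
    and \<pi> :: "real ^ 'm \<Rightarrow> 'x \<Rightarrow> 'a pmf"
    and \<phi> \<theta> :: "real ^ 'm"
    and V :: "'x \<Rightarrow> real" and \<epsilon> b :: real and C :: "'x set"
  defines "P\<^sub>\<phi> \<equiv> policy_matrix P (\<pi> \<phi>)" and "P\<^sub>\<theta> \<equiv> policy_matrix P (\<pi> \<theta>)"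
  assumes "\<And>x a. finite {y. pmf (P x a) y > 0}"
    and "open \<Theta>"
    and "\<And>t. t \<in> \<Theta> \<Longrightarrow> irreducible_chain (policy_matrix P (\<pi> t))"
    and "\<And>t. t \<in> \<Theta> \<Longrightarrow> aperiodic_chain (policy_matrix P (\<pi> t))"
    and "\<phi> \<in> \<Theta>"
    and "drift_condition P\<^sub>\<phi> V \<epsilon> b C"
    and "\<And>x. \<bar>g x\<bar> \<le> V x"
    and "\<theta> \<in> \<Theta>"
    and "policy_deviation V P\<^sub>\<theta> P\<^sub>\<phi> < 1"
  shows "(\<exists>!d. stationary_for P\<^sub>\<phi> d) \<and> dist_summable (stat_dist P\<^sub>\<phi>) g
       \<and> (\<exists>!d. stationary_for P\<^sub>\<theta> d) \<and> dist_summable (stat_dist P\<^sub>\<theta>) g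
       \<and> (\<forall>x y. summable (\<lambda>k. mat_pow (mat_diff P\<^sub>\<phi> (stat_matrix P\<^sub>\<phi>)) k x y))
       \<and> (\<forall>x. (\<lambda>y. fund_matrix P\<^sub>\<phi> x y * centred_cost P\<^sub>\<phi> g y) summable_on UNIV)
       \<and> dist_summable (stat_dist P\<^sub>\<phi>) (poisson_residual P\<^sub>\<theta> P\<^sub>\<phi> g)
       \<and> N2 V P\<^sub>\<theta> P\<^sub>\<phi> g < \<infinity>
       \<and> avg_cost P\<^sub>\<theta> g - avg_cost P\<^sub>\<phi> g \<le> N1 P\<^sub>\<theta> P\<^sub>\<phi> g + enn2real (N2 V P\<^sub>\<theta> P\<^sub>\<phi> g)"
proof -
  have drift: "drift_condition P\<^sub>\<phi> V \<epsilon> b C" by fact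
  then have V: "1 \<le> V x" for x by (simp add: drift_condition_def)
  have "0 < V x" for x using V[of x] by linarith
  moreover have chain: "finite_chain (policy_matrix P (\<pi> t))" for t
    using assms(3) by (rule finite_chain_policy_matrix)
  ultimately have wc: "weighted_chain (policy_matrix P (\<pi> t)) V" if "t \<in> \<Theta>" for t
    using that V assms(5) by (intro weighted_chain.intro weight.intro weighted_chain_axioms.intro) auto
  interpret drift_chain P\<^sub>\<phi> V \<epsilon> b C
    using wc[OF \<open>\<phi> \<in> \<Theta>\<close>] drift assms(6)[OF \<open>\<phi> \<in> \<Theta>\<close>] unfolding P\<^sub>\<phi>_def
    by (intro drift_chain.intro drift_chain_axioms.intro)
  have "weighted_chain P\<^sub>\<theta> V" unfolding P\<^sub>\<theta>_def by (rule wc) fact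
  then show ?thesis by (rule average_cost_bound) fact+
qed

end
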